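(* Let $n\ge 4$, let $D=D(H_n)$ be the distance matrix of the helm graph $H_n$ (of order $2n-1$), and let $S=\mathrm{Circ}(\mathbf{s}')$ with $\mathbf{s}=(2,1,0,\dots,0,1)'\in\mathbb{R}^{n-1}$. For a real matrix $L$ of order $2n-1$, the following are equivalent: (a) $L$ is Laplacian-like and there exist a non-zero $\alpha\in\mathbb{R}$ and $\mathbf{w}\in\mathbb{R}^{2n-1}$ with $\mathbf{e}'\mathbf{w}=1$ such that $D^{\dagger}=-\frac12L+\alpha\,\mathbf{w}\mathbf{w}'$. (b) $$L=\begin{bmatrix}\frac{n-1}{2}&-\frac12\mathbf{e}'&\mathbf{0}'\\ -\frac12\mathbf{e}&A&B\\ \mathbf{0}&B'&I_{n-1}\end{bmatrix}$$ for some real symmetric matrices $A$ and $B$ of order $n-1$ satisfying: (i) $A\mathbf{e}=\frac32\mathbf{e}$; (ii) $B\mathbf{e}=-\mathbf{e}$; (iii) $BS=-S$; (iv) $(B+I)A=O$; (v) $(B+I)B=O$; (vi) $(A+B)S+2B=O$.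
   Context: A prime denotes transpose; $\mathbf{e}$ and $\mathbf{0}$ are the all-ones and zero column vectors of the appropriate dimension, $J_{n-1}$ is the all-ones matrix and $I=I_{n-1}$ the identity of order $n-1$, $O$ a zero matrix. A real matrix is Laplacian-like if it is symmetric and all its row sums are zero. For $\mathbf{a}=(a_1,\dots,a_N)'\in\mathbb{R}^N$, $\mathrm{Circ}(\mathbf{a}')$ is the $N\times N$ circulant matrix with first row $(a_1,a_2,\dots,a_N)$, each subsequent row being the previous row cyclically shifted one place to the right. Helm graph: for $n\ge4$, the wheel $W_n$ consists of a cycle on $v_1,\dots,v_{n-1}$ together with a vertex $v_0$ adjacent to all $v_i$; the helm graph $H_n$ (on $2n-1$ vertices) is obtained from $W_n$ by attaching to each $v_i$, $1\le i\le n-1$, a pendant vertex $u_i$. The distance matrix $D(H_n)$ has as entries the shortest-path distances, with vertices ordered $v_0,v_1,\dots,v_{n-1},u_1,\dots,u_{n-1}$. Explicitly, $$D(H_n)=\begin{bmatrix}0&\mathbf{e}'&2\mathbf{e}'\\ \mathbf{e}&2J_{n-1}-S&3J_{n-1}-S\\ 2\mathbf{e}&3J_{n-1}-S&4J_{n-1}-S-2I_{n-1}\end{bmatrix}.$$ The Moore-Penrose inverse $M^\dagger$ of a real matrix $M$ is the unique $X$ with $MXM=M$, $XMX=X$, $(MX)'=MX$, $(XM)'=XM$. *)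

theory Defs
  imports
    "Jordan_Normal_Form.Matrix"
    "Graph_Theory.Graph_Theory"
begin

section \<open>Graphs and distance matrices\<close>

text \<open>
  Simple graphs are symmetric pair digraphs, as in the Graph\_Theory entry. The distance of two
  vertices is the infimum of the lengths of the walks between them, i.e. the shortest-path
  distance for the constant weight 1. It is an extended real, converted here to a real;
  the conversion loses nothing for connected graphs.
\<close>

definition graph_dist :: "'a pair_pre_digraph \<Rightarrow> 'a \<Rightarrow> 'a \<Rightarrow> real" where
  "graph_dist G u v = real_of_ereal (wf_digraph.\<mu> (with_proj G) (\<lambda>_. 1) u v)"

definition distance_mat :: "'a pair_pre_digraph \<Rightarrow> 'a list \<Rightarrow> real mat" where
  "distance_mat G vs = mat (length vs) (length vs) (\<lambda>(i, j). graph_dist G (vs ! i) (vs ! j))"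

datatype helm_vertex = V nat | U nat

definition wheel_graph :: "nat \<Rightarrow> helm_vertex pair_pre_digraph" where
  "wheel_graph n = mk_symmetric (with_proj
     \<lparr> pverts = V ` {0..<n},
       parcs = {(V i, V (i + 1)) | i. 1 \<le> i \<and> i < n - 1} \<union> {(V (n - 1), V 1)}
             \<union> {(V 0, V i) | i. 1 \<le> i \<and> i \<le> n - 1} \<rparr>)"

definition helm_graph :: "nat \<Rightarrow> helm_vertex pair_pre_digraph" where
  "helm_graph n = mk_symmetric (with_proj
     \<lparr> pverts = pverts (wheel_graph n) \<union> U ` {1..<n},
       parcs = parcs (wheel_graph n) \<union> {(V i, U i) | i. 1 \<le> i \<and> i \<le> n - 1} \<rparr>)"

text \<open>The vertex ordering $v_0, v_1, \dots, v_{n-1}, u_1, \dots, u_{n-1}$.\<close>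

definition helm_vertices :: "nat \<Rightarrow> helm_vertex list" where
  "helm_vertices n = map V [0..<n] @ map U [1..<n]"

lemma parcs_mk_symmetric_with_proj: "parcs (mk_symmetric (with_proj G)) = symcl (parcs G)"
  unfolding mk_symmetric_def with_proj_simps symcl_def by auto

lemma symcl_Un_symcl: "symcl (symcl R \<union> T) = symcl (R \<union> T)"
  unfolding symcl_def image_Un image_image by auto

lemma parcs_helm_graph:
  "parcs (helm_graph n) = symcl
     ({(V i, V (i + 1)) | i. 1 \<le> i \<and> i < n - 1} \<union> {(V (n - 1), V 1)}
      \<union> {(V 0, V i) | i. 1 \<le> i \<and> i \<le> n - 1} \<union> {(V i, U i) | i. 1 \<le> i \<and> i \<le> n - 1})"
  unfolding helm_graph_def wheel_graph_def parcs_mk_symmetric_with_proj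
    pair_pre_digraph.simps symcl_Un_symcl ..

lemma pverts_helm_graph: "pverts (helm_graph n) = V ` {0..<n} \<union> U ` {1..<n}"
  by (simp add: helm_graph_def wheel_graph_def mk_symmetric_def)

lemma set_helm_vertices: "set (helm_vertices n) = pverts (helm_graph n)"
  by (simp add: helm_vertices_def pverts_helm_graph)

lemma pair_graph_helm_graph:
  assumes "n \<ge> 4"
  shows "pair_graph (helm_graph n)"
proof -
  have fin: "finite (pverts (helm_graph n))"
    by (simp add: pverts_helm_graph)
  have sub: "parcs (helm_graph n) \<subseteq> pverts (helm_graph n) \<times> pverts (helm_graph n)"
    using assms by (auto simp: parcs_helm_graph pverts_helm_graph symcl_def)
  have fin': "finite (parcs (helm_graph n))"
    using sub fin by (meson finite_SigmaI finite_subset)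
  have loop: "fst e \<noteq> snd e" if "e \<in> parcs (helm_graph n)" for e
    using assms that by (auto simp: parcs_helm_graph symcl_def)
  have sym: "symmetric (with_proj (helm_graph n))"
    by (auto simp: symmetric_def sym_def parcs_helm_graph symcl_def)
  show ?thesis
    using fin fin' sub loop sym by unfold_locales auto
qed


section \<open>Matrices\<close>

abbreviation ones_vec :: "nat \<Rightarrow> real vec" where
  "ones_vec n \<equiv> vec n (\<lambda>_. 1)"

definition symmetric_mat :: "real mat \<Rightarrow> bool" where
  "symmetric_mat M \<longleftrightarrow> transpose_mat M = M"

definition laplacian_like :: "real mat \<Rightarrow> bool" where
  "laplacian_like M \<longleftrightarrow>
     symmetric_mat M \<and> (\<forall>i < dim_row M. (\<Sum>j < dim_col M. M $$ (i, j)) = 0)"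

text \<open>Row \<open>i\<close> is the first row cyclically shifted \<open>i\<close> places to the right (indices from 0).\<close>

definition circ :: "real vec \<Rightarrow> real mat" where
  "circ a = (let N = dim_vec a in mat N N (\<lambda>(i, j). a $ ((j + (N - i)) mod N)))"

definition outer_prod :: "real vec \<Rightarrow> real vec \<Rightarrow> real mat" where
  "outer_prod v w = transpose_mat (mat_of_row v) * mat_of_row w"

definition is_moore_penrose_inverse :: "real mat \<Rightarrow> real mat \<Rightarrow> bool" where
  "is_moore_penrose_inverse M X \<longleftrightarrow>
     X \<in> carrier_mat (dim_col M) (dim_row M) \<and>
     M * X * M = M \<and> X * M * X = X \<and>
     transpose_mat (M * X) = M * X \<and> transpose_mat (X * M) = X * M"

definition moore_penrose_inverse :: "real mat \<Rightarrow> real mat" where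
  "moore_penrose_inverse M = (THE X. is_moore_penrose_inverse M X)"

lemma is_moore_penrose_inverse_unique:
  assumes X: "is_moore_penrose_inverse M X" and Y: "is_moore_penrose_inverse M Y"
  shows "X = Y"
proof -
  define m n where "m = dim_row M" and "n = dim_col M"
  have M: "M \<in> carrier_mat m n"
    unfolding m_def n_def by (rule carrier_matI) simp_all
  have Xc: "X \<in> carrier_mat n m" and Yc: "Y \<in> carrier_mat n m"
    using X Y by (simp_all add: is_moore_penrose_inverse_def m_def n_def)
  note c = M Xc Yc
  note assoc = assoc_mult_mat[of _ m n _ m _ n] assoc_mult_mat[of _ m n _ m _ m]
    assoc_mult_mat[of _ m n _ n _ m] assoc_mult_mat[of _ m m _ n _ m]
    assoc_mult_mat[of _ n m _ n _ m] assoc_mult_mat[of _ n m _ n _ n]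
    assoc_mult_mat[of _ n m _ m _ n] assoc_mult_mat[of _ n n _ m _ n]
  have MX: "M * X = M * Y"
  proof -
    have "M * X = (M * Y * M) * X"
      using Y by (simp add: is_moore_penrose_inverse_def)
    also have "\<dots> = (M * Y) * (M * X)"
      using c by (simp add: assoc)
    also have "\<dots> = transpose_mat (M * Y) * transpose_mat (M * X)"
      using X Y by (simp add: is_moore_penrose_inverse_def)
    also have "\<dots> = transpose_mat ((M * X) * (M * Y))"
      using c by (simp add: transpose_mult[of _ m m _ m])
    also have "(M * X) * (M * Y) = (M * X * M) * Y"
      using c by (simp add: assoc)
    also have "\<dots> = M * Y"
      using X by (simp add: is_moore_penrose_inverse_def)
    also have "transpose_mat (M * Y) = M * Y"
      using Y by (simp add: is_moore_penrose_inverse_def)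
    finally show ?thesis .
  qed
  have XM: "X * M = Y * M"
  proof -
    have "X * M = X * (M * Y * M)"
      using Y by (simp add: is_moore_penrose_inverse_def)
    also have "\<dots> = (X * M) * (Y * M)"
      using c by (simp add: assoc)
    also have "\<dots> = transpose_mat (X * M) * transpose_mat (Y * M)"
      using X Y by (simp add: is_moore_penrose_inverse_def)
    also have "\<dots> = transpose_mat ((Y * M) * (X * M))"
      using c by (simp add: transpose_mult[of _ n n _ n])
    also have "(Y * M) * (X * M) = Y * (M * X * M)"
      using c by (simp add: assoc)
    also have "\<dots> = Y * M"
      using X by (simp add: is_moore_penrose_inverse_def)
    also have "transpose_mat (Y * M) = Y * M"
      using Y by (simp add: is_moore_penrose_inverse_def)
    finally show ?thesis .
  qed
  have "X = X * M * X"
    using X by (simp add: is_moore_penrose_inverse_def)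
  also have "\<dots> = Y * M * X"
    by (simp add: XM)
  also have "\<dots> = Y * (M * X)"
    using c by (simp add: assoc)
  also have "\<dots> = Y * M * Y"
    using c by (simp add: MX assoc)
  also have "\<dots> = Y"
    using Y by (simp add: is_moore_penrose_inverse_def)
  finally show ?thesis .
qed

lemma moore_penrose_inverse_eqI:
  "is_moore_penrose_inverse M X \<Longrightarrow> moore_penrose_inverse M = X"
  unfolding moore_penrose_inverse_def
  using is_moore_penrose_inverse_unique by blast

end

theory Submission
  imports Defs "Jordan_Normal_Form.Determinant" "HOL-Number_Theory.Cong"
begin

text \<open>Put \<open>m = n - 1\<close> and \<open>w = (4 - m, -e', 2e')' / 4\<close>; then \<open>e'w = 1\<close> and \<open>D w = (3m/4) e\<close>.
  The kernel of \<open>D\<close> is \<open>{(0, x', 0)' | S x = 0}\<close>, which is orthogonal to both \<open>e\<close> and \<open>w\<close>. If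
  \<open>D\<^sup>\<dagger> = -L/2 + \<alpha> v v'\<close> with \<open>L e = 0\<close> and \<open>e'v = 1\<close>, then \<open>D\<^sup>\<dagger> e = \<alpha> v\<close> forces \<open>v = w\<close> and
  \<open>\<alpha> = 4/(3m)\<close>, so \<open>D L = 2 e w' - 2 P\<close> for the projection \<open>P = D D\<^sup>\<dagger> = diag(1, Q, I)\<close>, where \<open>Q\<close>
  projects onto the range of \<open>S\<close>. Comparing blocks gives (b) with \<open>B = -Q\<close>. Conversely, the
  conditions in (b) say exactly that \<open>D X = diag(1, -B, I)\<close> for \<open>X = -L/2 + 4/(3m) w w'\<close> and that
  this matrix is a projection fixing \<open>D\<close> and \<open>X\<close>.\<close>

section \<open>Distances in the helm graph\<close>

text \<open>A potential \<open>d\<close> certifies all distances to \<open>v\<close>. The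
  \<open>lipschitz\<close> condition makes \<open>d\<close> a lower bound for the length of every
  walk to \<open>v\<close>; \<open>descent\<close> lets a walk drop \<open>d\<close> by one at each
  arc, so the bound is attained.\<close>

lemma (in wf_digraph) mu_unit_eqI:
  fixes d :: "'a \<Rightarrow> nat"
  assumes "d v = 0" "v \<in> verts G" "u \<in> verts G"
    and lipschitz: "\<And>e. e \<in> arcs G \<Longrightarrow> d (tail G e) \<le> Suc (d (head G e))"
    and descent: "\<And>x. x \<in> verts G \<Longrightarrow> x \<noteq> v \<Longrightarrow>
      \<exists>e \<in> arcs G. tail G e = x \<and> d x = Suc (d (head G e))"
  shows "\<mu> (\<lambda>_. 1) u v = ereal (d u)"
proof -
  have cost: "awalk_cost (\<lambda>_. 1) p = length p" for p
    by (induction p) auto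
  have lower: "awalk x p v \<Longrightarrow> d x \<le> length p" for x p
  proof (induction p arbitrary: x)
    case Nil
    then show ?case using assms(1) by (auto simp: awalk_simps)
  next
    case (Cons e p)
    then show ?case using lipschitz[of e] by (fastforce simp: awalk_simps)
  qed
  have upper: "x \<in> verts G \<Longrightarrow> d x = k \<Longrightarrow> \<exists>p. awalk x p v \<and> length p = k" for x k
  proof (induction k arbitrary: x)
    case 0
    then have "x = v" using descent[of x] by auto
    then show ?case using assms(2) by (auto simp: awalk_simps)
  next
    case (Suc k)
    then have "x \<noteq> v" using assms(1) by auto
    then obtain e where e: "e \<in> arcs G" "tail G e = x" "d x = Suc (d (head G e))"
      using descent[of x] Suc.prems by blast
    then obtain p where "awalk (head G e) p v" "length p = k"
      using Suc by (metis Suc_inject head_in_verts)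
    then have "awalk x (e # p) v" "length (e # p) = Suc k"
      using e Suc.prems by (auto simp: awalk_simps)
    then show ?case by blast
  qed
  show ?thesis
  proof (rule antisym)
    obtain p where "awalk u p v" "length p = d u" using upper assms(3) by blast
    then show "\<mu> (\<lambda>_. 1) u v \<le> ereal (d u)"
      using min_cost_le_walk_cost[of u p v "\<lambda>_. 1"] by (simp add: cost)
    show "ereal (d u) \<le> \<mu> (\<lambda>_. 1) u v"
      unfolding \<mu>_def by (rule INF_greatest) (auto simp: cost dest: lower)
  qed
qed

text \<open>Distance inside the wheel, with the hub as index 0. The last two disjuncts are the
  wrap-around edge of the cycle; all other pairs of distinct rim vertices are joined through the
  hub.\<close>

definition rim_dist :: "nat \<Rightarrow> nat \<Rightarrow> nat \<Rightarrow> nat" where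
  "rim_dist n i j =
     (if i = j then 0
      else if i = 0 \<or> j = 0 \<or> i + 1 = j \<or> j + 1 = i \<or> i = 1 \<and> j = n - 1 \<or> j = 1 \<and> i = n - 1
        then 1
      else 2)"

text \<open>Each pendant endpoint adds one step to the wheel distance, except that the two steps
  must not be counted from a pendant vertex to itself.\<close>

fun helm_dist :: "nat \<Rightarrow> helm_vertex \<Rightarrow> helm_vertex \<Rightarrow> nat" where
  "helm_dist n (V i) (V j) = rim_dist n i j"
| "helm_dist n (V i) (U j) = rim_dist n i j + 1"
| "helm_dist n (U i) (V j) = rim_dist n i j + 1"
| "helm_dist n (U i) (U j) = (if i = j then 0 else rim_dist n i j + 2)"

lemma in_symcl_iff: "(x, y) \<in> symcl R \<longleftrightarrow> (x, y) \<in> R \<or> (y, x) \<in> R"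
  by (auto simp: symcl_def)

lemma helm_graph_arc_V_V:
  assumes "n \<ge> 4"
  shows "(V i, V j) \<in> parcs (helm_graph n) \<longleftrightarrow> i < n \<and> j < n \<and> rim_dist n i j = 1"
proof -
  have "(V i, V j) \<in> parcs (helm_graph n) \<longleftrightarrow>
      1 \<le> i \<and> i < n - 1 \<and> j = i + 1 \<or> 1 \<le> j \<and> j < n - 1 \<and> i = j + 1 \<or>
      i = n - 1 \<and> j = 1 \<or> j = n - 1 \<and> i = 1 \<or>
      i = 0 \<and> 1 \<le> j \<and> j \<le> n - 1 \<or> j = 0 \<and> 1 \<le> i \<and> i \<le> n - 1"
    by (auto simp: parcs_helm_graph in_symcl_iff)
  also have "\<dots> \<longleftrightarrow> i < n \<and> j < n \<and>
      i \<noteq> j \<and> (i = 0 \<or> j = 0 \<or> i + 1 = j \<or> j + 1 = i \<or> i = 1 \<and> j = n - 1 \<or> j = 1 \<and> i = n - 1)"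
    using assms by (cases "i = 0"; cases "j = 0") auto
  also have "\<dots> \<longleftrightarrow> i < n \<and> j < n \<and> rim_dist n i j = 1"
    by (simp add: rim_dist_def)
  finally show ?thesis .
qed

lemma helm_graph_arc_V_U:
  "(V i, U j) \<in> parcs (helm_graph n) \<longleftrightarrow> i = j \<and> 1 \<le> j \<and> j < n"
  by (auto simp: parcs_helm_graph in_symcl_iff)

lemma helm_graph_arc_U_V:
  "(U i, V j) \<in> parcs (helm_graph n) \<longleftrightarrow> i = j \<and> 1 \<le> j \<and> j < n"
  by (auto simp: parcs_helm_graph in_symcl_iff)

lemma helm_graph_arc_U_U: "(U i, U j) \<notin> parcs (helm_graph n)"
  by (auto simp: parcs_helm_graph in_symcl_iff)

lemmas helm_graph_arcs =
  helm_graph_arc_V_V helm_graph_arc_V_U helm_graph_arc_U_V helm_graph_arc_U_U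

lemma rim_dist_self [simp]: "rim_dist n i i = 0"
  by (simp add: rim_dist_def)

lemma rim_dist_eq_0_iff [simp]: "rim_dist n i j = 0 \<longleftrightarrow> i = j"
  by (simp add: rim_dist_def)

lemma rim_dist_le_2: "rim_dist n i j \<le> 2"
  by (simp add: rim_dist_def)

text \<open>All values are at most 2, so the inequality is at risk only when the second distance is
  0, that is, when \<open>k = j\<close>; there it is the assumption.\<close>

lemma rim_dist_le_Suc:
  assumes "rim_dist n i k = 1"
  shows "rim_dist n i j \<le> Suc (rim_dist n k j)"
proof (cases "k = j")
  case False
  then have "rim_dist n k j \<noteq> 0" by simp
  then show ?thesis using rim_dist_le_2[of n i j] by linarith
qed (use assms in simp)

lemma helm_dist_lipschitz:
  assumes "n \<ge> 4" "(x, y) \<in> parcs (helm_graph n)"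
  shows "helm_dist n x v \<le> Suc (helm_dist n y v)"
  using assms by (cases x; cases y; cases v) (auto simp: helm_graph_arcs rim_dist_le_Suc)

text \<open>At distance 1 the step goes straight to \<open>j\<close>; at distance 2 it goes to the
  hub.\<close>

lemma rim_dist_descent:
  assumes "n \<ge> 4" "i < n" "j < n" "i \<noteq> j"
  obtains k where "(V i, V k) \<in> parcs (helm_graph n)" "rim_dist n i j = Suc (rim_dist n k j)"
proof (cases "rim_dist n i j = 1")
  case True
  then have "(V i, V j) \<in> parcs (helm_graph n)"
    using assms by (simp add: helm_graph_arcs)
  then show ?thesis using that True by simp
next
  case False
  then have "i \<noteq> 0" "j \<noteq> 0" "rim_dist n i j = 2"
    using assms by (auto simp: rim_dist_def split: if_splits)
  then have "(V i, V 0) \<in> parcs (helm_graph n)" "rim_dist n i j = Suc (rim_dist n 0 j)"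
    using assms by (auto simp: helm_graph_arcs rim_dist_def)
  then show ?thesis using that by blast
qed

text \<open>A pendant vertex first moves to its rim vertex. A wheel vertex follows
  \<open>rim_dist_descent\<close>, unless the target is its own pendant vertex, which is then
  entered directly.\<close>

lemma helm_dist_descent:
  assumes "n \<ge> 4" "x \<in> pverts (helm_graph n)" "v \<in> pverts (helm_graph n)" "x \<noteq> v"
  shows "\<exists>y. (x, y) \<in> parcs (helm_graph n) \<and> helm_dist n x v = Suc (helm_dist n y v)"
proof (cases x)
  case (U i)
  then have "(U i, V i) \<in> parcs (helm_graph n)"
    using assms by (auto simp: pverts_helm_graph helm_graph_arcs)
  moreover have "helm_dist n x v = Suc (helm_dist n (V i) v)"
    using U assms by (cases v) auto
  ultimately show ?thesis using U by blast
next
  case V: (V i)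
  then have i: "i < n" using assms by (auto simp: pverts_helm_graph)
  show ?thesis
  proof (cases v)
    case (V j)
    then have "j < n" "i \<noteq> j" using assms \<open>x = V i\<close> by (auto simp: pverts_helm_graph)
    then obtain k where "(V i, V k) \<in> parcs (helm_graph n)" "rim_dist n i j = Suc (rim_dist n k j)"
      using rim_dist_descent assms(1) i by blast
    then show ?thesis using V \<open>x = V i\<close> by (intro exI[of _ "V k"]) simp
  next
    case (U j)
    then have j: "1 \<le> j" "j < n" using assms by (auto simp: pverts_helm_graph)
    show ?thesis
    proof (cases "i = j")
      case True
      then show ?thesis using U V j by (intro exI[of _ v]) (simp add: helm_graph_arcs)
    next
      case False
      then obtain k where "(V i, V k) \<in> parcs (helm_graph n)" "rim_dist n i j = Suc (rim_dist n k j)"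
        using rim_dist_descent assms(1) i j by blast
      then show ?thesis using U V by (intro exI[of _ "V k"]) simp
    qed
  qed
qed

lemma graph_dist_helm_graph:
  assumes "n \<ge> 4" "x \<in> pverts (helm_graph n)" "v \<in> pverts (helm_graph n)"
  shows "graph_dist (helm_graph n) x v = helm_dist n x v"
proof -
  interpret pair_graph "helm_graph n" by (rule pair_graph_helm_graph) fact
  have "\<mu> (\<lambda>_. 1) x v = ereal (helm_dist n x v)"
  proof (rule mu_unit_eqI[where d = "\<lambda>y. helm_dist n y v"])
    show "helm_dist n v v = 0" by (cases v) auto
    show "helm_dist n (fst e) v \<le> Suc (helm_dist n (snd e) v)"
      if "e \<in> parcs (helm_graph n)" for e
      using that helm_dist_lipschitz[OF assms(1), of "fst e" "snd e"] by simp
    show "\<exists>e\<in>parcs (helm_graph n). fst e = y \<and>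
        helm_dist n y v = Suc (helm_dist n (snd e) v)"
      if y: "y \<in> pverts (helm_graph n)" "y \<noteq> v" for y
    proof -
      obtain z where "(y, z) \<in> parcs (helm_graph n)" "helm_dist n y v = Suc (helm_dist n z v)"
        using helm_dist_descent[OF assms(1) y(1) assms(3) y(2)] by blast
      then show ?thesis by (intro bexI[of _ "(y, z)"]) simp_all
    qed
  qed (use assms in simp_all)
  then show ?thesis by (simp add: graph_dist_def)
qed

section \<open>The circulant matrix S and distances on the rim\<close>

lemma rim_dist_commute: "rim_dist n i j = rim_dist n j i"
  by (auto simp: rim_dist_def)

text \<open>The cyclic shift permutes the index set, so every row is a rearrangement of
  \<open>a\<close>.\<close>

lemma row_sum_circ:
  assumes "i < dim_vec a"
  shows "(\<Sum>j<dim_vec a. circ a $$ (i, j)) = (\<Sum>j<dim_vec a. a $ j)"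
proof -
  let ?N = "dim_vec a" and ?h = "\<lambda>j. (j + (dim_vec a - i)) mod dim_vec a"
  have "inj_on ?h {..<?N}"
  proof (rule inj_onI)
    fix x y assume xy: "x \<in> {..<?N}" "y \<in> {..<?N}" "?h x = ?h y"
    then have "[x = y] (mod ?N)" by (metis cong_add_rcancel_nat cong_def)
    then show "x = y" using xy by (simp add: cong_def)
  qed
  then have "bij_betw ?h {..<?N} {..<?N}"
    using assms by (intro bij_betw_imageI endo_inj_surj) auto
  then show ?thesis
    using assms by (subst sum.reindex_bij_betw[symmetric, of ?h "{..<?N}"]) (auto simp: circ_def Let_def)
qed

text \<open>This identifies S with 2J minus the matrix of rim distances, which is the form in which
  S enters D. Position \<open>i\<close> of the circulant belongs to the vertex
  \<open>V (Suc i)\<close>.\<close>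

lemma index_circ_rim:
  assumes "n \<ge> 4" "i < n - 1" "j < n - 1"
  shows "circ (vec (n - 1) (\<lambda>i. if i = 0 then 2 else if i = 1 \<or> i = n - 2 then 1 else 0)) $$ (i, j)
    = 2 - real (rim_dist n (Suc i) (Suc j))"
proof -
  let ?k = "(j + (n - 1 - i)) mod (n - 1)"
  \<comment> \<open>The offset j - i modulo n - 1, made explicit to remove
    \<open>mod\<close>.\<close>
  have k: "?k = (if i \<le> j then j - i else j + (n - 1 - i))"
  proof (cases "i \<le> j")
    case True
    then have "?k = ((j - i) + (n - 1)) mod (n - 1)" using assms by simp
    then show ?thesis using True assms by (simp only: mod_add_self2) auto
  qed (use assms in auto)
  have "?k < n - 1" using assms by simp
  then have "circ (vec (n - 1) (\<lambda>i. if i = 0 then 2 else if i = 1 \<or> i = n - 2 then 1 else 0)) $$ (i, j)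
    = (if ?k = 0 then 2 else if ?k = 1 \<or> ?k = n - 2 then 1 else 0 :: real)"
    using assms by (simp add: circ_def Let_def)
  also have "\<dots> = 2 - real (rim_dist n (Suc i) (Suc j))"
  proof (cases i j rule: linorder_cases)
    case less
    \<comment> \<open>Adjacency on the rim for i < j: consecutive vertices have offset 1, and the
      ends of the wrap-around edge have offset n - 2.\<close>
    let ?C = "j = i + 1 \<or> i = 0 \<and> j = n - 2"
    have "?k = j - i" using k less by simp
    moreover have "j - i \<noteq> 0" "j - i = 1 \<or> j - i = n - 2 \<longleftrightarrow> ?C"
      using less assms by linarith+
    ultimately have k': "?k \<noteq> 0" "?k = 1 \<or> ?k = n - 2 \<longleftrightarrow> ?C" by presburger+
    have "Suc i \<noteq> Suc j" "Suc i \<noteq> 0" "Suc j \<noteq> 0" "Suc j \<noteq> 1" "Suc j + 1 \<noteq> Suc i"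
      "Suc i = 1 \<longleftrightarrow> i = 0" "Suc j = n - 1 \<longleftrightarrow> j = n - 2" "Suc i + 1 = Suc j \<longleftrightarrow> j = i + 1"
      using less assms by linarith+
    then have "rim_dist n (Suc i) (Suc j) = (if ?C then 1 else 2)"
      by (simp only: rim_dist_def simp_thms if_False)
    then show ?thesis by (simp only: k' if_False) simp
  next
    case equal
    then show ?thesis using k by simp
  next
    case greater
    let ?C = "i = j + 1 \<or> j = 0 \<and> i = n - 2"
    have "?k = j + (n - 1 - i)" using k greater by simp
    moreover have "j + (n - 1 - i) \<noteq> 0" "j + (n - 1 - i) = 1 \<or> j + (n - 1 - i) = n - 2 \<longleftrightarrow> ?C"
      using greater assms by linarith+
    ultimately have k': "?k \<noteq> 0" "?k = 1 \<or> ?k = n - 2 \<longleftrightarrow> ?C" by presburger+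
    have "Suc i \<noteq> Suc j" "Suc i \<noteq> 0" "Suc j \<noteq> 0" "Suc i \<noteq> 1" "Suc i + 1 \<noteq> Suc j"
      "Suc j = 1 \<longleftrightarrow> j = 0" "Suc i = n - 1 \<longleftrightarrow> i = n - 2" "Suc j + 1 = Suc i \<longleftrightarrow> i = j + 1"
      using greater assms by linarith+
    then have "rim_dist n (Suc i) (Suc j) = (if ?C then 1 else 2)"
      by (simp only: rim_dist_def simp_thms if_False)
    then show ?thesis by (simp only: k' if_False) simp
  qed
  finally show ?thesis .
qed

section \<open>Moore-Penrose inverses of symmetric matrices\<close>

lemma index_outer_prod [simp]:
  "i < dim_vec v \<Longrightarrow> j < dim_vec w \<Longrightarrow> outer_prod v w $$ (i, j) = v $ i * w $ j"
  by (simp add: outer_prod_def scalar_prod_def)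

lemma dim_outer_prod [simp]:
  "dim_row (outer_prod v w) = dim_vec v" "dim_col (outer_prod v w) = dim_vec w"
  by (simp_all add: outer_prod_def)

lemma outer_prod_carrier [simp]:
  "v \<in> carrier_vec n \<Longrightarrow> w \<in> carrier_vec k \<Longrightarrow> outer_prod v w \<in> carrier_mat n k"
  by (metis carrier_vecD carrier_matI dim_outer_prod)

lemma index_mult_mat_sum:
  assumes "A \<in> carrier_mat r k" "B \<in> carrier_mat k c" "i < r" "j < c"
  shows "(A * B) $$ (i, j) = (\<Sum>l<k. A $$ (i, l) * B $$ (l, j))"
  using assms by (simp add: scalar_prod_def lessThan_atLeast0)

lemma mult_mat_outer_prod:
  assumes "A \<in> carrier_mat r k" "u \<in> carrier_vec k"
  shows "A * outer_prod u v = outer_prod (A *\<^sub>v u) v"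
proof (rule eq_matI)
  fix i j assume "i < dim_row (outer_prod (A *\<^sub>v u) v)" "j < dim_col (outer_prod (A *\<^sub>v u) v)"
  then show "(A * outer_prod u v) $$ (i, j) = outer_prod (A *\<^sub>v u) v $$ (i, j)"
    using assms by (auto simp: scalar_prod_def sum_distrib_right mult.assoc)
qed (use assms in auto)

lemma outer_prod_mult_vec:
  assumes "v \<in> carrier_vec k" "x \<in> carrier_vec k"
  shows "outer_prod u v *\<^sub>v x = (v \<bullet> x) \<cdot>\<^sub>v u"
  using assms by (intro eq_vecI) (auto simp: scalar_prod_def sum_distrib_left mult_ac)

text \<open>For symmetric idempotent \<open>K\<close> a diagonal entry equals the sum of squares of
  its row, hence is at least its own square and so at most 1.\<close>

lemma symmetric_idempotent_trace_le:
  fixes K :: "real mat"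
  assumes K: "K \<in> carrier_mat n n" and "transpose_mat K = K" "K * K = K"
  shows "(\<Sum>i<n. K $$ (i, i)) \<le> n"
proof -
  have "K $$ (i, i) \<le> 1" if "i < n" for i
  proof -
    have sym: "K $$ (j, i) = K $$ (i, j)" if "j < n" for j
      using that \<open>i < n\<close> assms by (metis carrier_matD index_transpose_mat(1))
    have "(K $$ (i, i))\<^sup>2 \<le> (\<Sum>j<n. (K $$ (i, j))\<^sup>2)"
      using that by (intro member_le_sum) auto
    also have "\<dots> = (K * K) $$ (i, i)"
      using that sym by (subst index_mult_mat_sum[OF K K]) (auto simp: power2_eq_square)
    finally have "(K $$ (i, i))\<^sup>2 \<le> K $$ (i, i)" using assms by simp
    then show ?thesis by (metis le_cases linorder_not_le mult_le_cancel_right2 order_trans power2_eq_square zero_le_one)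
  qed
  then have "(\<Sum>i<n. K $$ (i, i)) \<le> (\<Sum>i<n. 1)" by (intro sum_mono) auto
  then show ?thesis by simp
qed

text \<open>The trace of a symmetric idempotent \<open>K\<close> with \<open>M K = O\<close> grows by 1 whenever \<open>K\<close> is enlarged by
  the projection onto a vector in the kernel of \<open>M + K\<close>, so the process stops. Then
  \<open>(M + K)\<^sup>-\<^sup>1 - K\<close> is the Moore-Penrose inverse of \<open>M\<close>.\<close>

lemma ex_kernel_projection:
  fixes M :: "real mat"
  assumes M: "M \<in> carrier_mat n n" and sym: "transpose_mat M = M"
  obtains K where "K \<in> carrier_mat n n" "transpose_mat K = K" "K * K = K" "M * K = 0\<^sub>m n n"
    "det (M + K) \<noteq> 0"
proof -
  define good where "good K \<longleftrightarrow> K \<in> carrier_mat n n \<and> transpose_mat K = K \<and> K * K = K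
    \<and> M * K = 0\<^sub>m n n" for K
  have extend: "\<exists>K'. good K' \<and> (\<Sum>i<n. K' $$ (i, i)) = (\<Sum>i<n. K $$ (i, i)) + 1"
    if K: "good K" and det: "det (M + K) = 0" for K
  proof -
    have Kc: "K \<in> carrier_mat n n" using K by (simp add: good_def)
    have KM: "K * M = 0\<^sub>m n n"
      using K M sym transpose_mult[OF M Kc] by (simp add: good_def)
    obtain v where v: "v \<in> carrier_vec n" "v \<noteq> 0\<^sub>v n" and ker: "(M + K) *\<^sub>v v = 0\<^sub>v n"
      using det det_0_iff_vec_prod_zero[of "M + K" n] M Kc by auto
    \<comment> \<open>Since K M = O and K K = K, applying \<open>K\<close> to (M + K) v = 0 isolates
      K v = 0, and then M v = 0 as well.\<close>
    have "K *\<^sub>v ((M + K) *\<^sub>v v) = (K * (M + K)) *\<^sub>v v"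
      using v M Kc by (intro assoc_mult_mat_vec[symmetric]) auto
    also have "K * (M + K) = K"
      using K KM M Kc by (simp add: mult_add_distrib_mat[OF Kc M Kc] good_def)
    moreover have "K *\<^sub>v 0\<^sub>v n = 0\<^sub>v n" using Kc by (intro eq_vecI) auto
    ultimately have Kv: "K *\<^sub>v v = 0\<^sub>v n" using ker by simp
    then have Mv: "M *\<^sub>v v = 0\<^sub>v n"
      using ker v M Kc by (simp add: add_mult_distrib_mat_vec[OF M Kc])
    define c where "c = v \<bullet> v"
    have c: "c > 0"
    proof -
      obtain i where i: "i < n" "v $ i \<noteq> 0" using v by (metis carrier_vecD eq_vecI index_zero_vec)
      then have "0 < v $ i * v $ i" using not_real_square_gt_zero by blast
      also have "\<dots> \<le> (\<Sum>i\<in>{0..<n}. v $ i * v $ i)"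
        using i by (intro member_le_sum) auto
      finally show ?thesis using v by (simp add: c_def scalar_prod_def)
    qed
    \<comment> \<open>\<open>?F\<close> is the orthogonal projection onto the line of
      \<open>v\<close>. As K v = 0, its products with \<open>K\<close> vanish on both sides, so
      \<open>K + ?F\<close> is again a projection; its trace is larger by 1.\<close>
    let ?E = "outer_prod v v" and ?F = "(1 / c) \<cdot>\<^sub>m outer_prod v v"
    have E: "?E \<in> carrier_mat n n" and F: "?F \<in> carrier_mat n n" using v by auto
    have z: "outer_prod (0\<^sub>v n) v = 0\<^sub>m n n" using v by (intro eq_matI) auto
    have KF: "K * ?F = 0\<^sub>m n n"
      using v by (simp add: mult_smult_distrib[OF Kc E] mult_mat_outer_prod[OF Kc] Kv z)
    have MF: "M * ?F = 0\<^sub>m n n"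
      using v by (simp add: mult_smult_distrib[OF M E] mult_mat_outer_prod[OF M] Mv z)
    have tF: "transpose_mat ?F = ?F" using v by (intro eq_matI) auto
    have FK: "?F * K = 0\<^sub>m n n"
      using KF transpose_mult[OF Kc F] K tF by (simp add: good_def)
    have "?E * ?E = c \<cdot>\<^sub>m ?E"
      using v by (simp add: mult_mat_outer_prod[OF E] outer_prod_mult_vec c_def) (intro eq_matI; simp)
    then have FF: "?F * ?F = ?F"
      using c v by (simp add: mult_smult_distrib[OF F E] mult_smult_assoc_mat[OF E E])
        (intro eq_matI; simp)
    have "good (K + ?F)"
      unfolding good_def
    proof (intro conjI)
      show "transpose_mat (K + ?F) = K + ?F"
        using K tF by (simp add: transpose_add[OF Kc F] good_def)
      show "(K + ?F) * (K + ?F) = K + ?F"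
        using K Kc F KF FK FF by (simp add: add_mult_distrib_mat[OF Kc F, of _ n]
          mult_add_distrib_mat[OF _ Kc F] good_def)
      show "M * (K + ?F) = 0\<^sub>m n n"
        using K MF by (simp add: mult_add_distrib_mat[OF M Kc F] good_def)
    qed (use Kc F in auto)
    moreover have "(\<Sum>i<n. ?F $$ (i, i)) = 1"
      using v c by (simp add: c_def scalar_prod_def lessThan_atLeast0 flip: sum_divide_distrib)
    then have "(\<Sum>i<n. (K + ?F) $$ (i, i)) = (\<Sum>i<n. K $$ (i, i)) + 1"
      using Kc F v by (simp add: sum.distrib)
    ultimately show ?thesis by blast
  qed
  have "\<exists>K. good K \<and> det (M + K) \<noteq> 0"
  proof (rule ccontr)
    assume no: "\<not> ?thesis"
    \<comment> \<open>Starting from the zero matrix, repeated extension would reach every natural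
      number as a trace, contradicting the bound \<open>n\<close>.\<close>
    have "\<exists>K. good K \<and> (\<Sum>i<n. K $$ (i, i)) = real t" for t
    proof (induction t)
      case 0
      have "good (0\<^sub>m n n)" using M by (simp add: good_def)
      then show ?case by (intro exI[of _ "0\<^sub>m n n"]) auto
    next
      case (Suc t)
      then obtain K where "good K" "(\<Sum>i<n. K $$ (i, i)) = real t" by blast
      then show ?case using extend[of K] no by (auto simp: add.commute)
    qed
    from this[of "Suc n"] obtain K where "good K" "(\<Sum>i<n. K $$ (i, i)) = real (Suc n)" by blast
    then show False using symmetric_idempotent_trace_le[of K n] by (auto simp: good_def)
  qed
  then show thesis using that by (auto simp: good_def)
qed

lemma ex_moore_penrose_inverse_symmetric:
  fixes M :: "real mat"
  assumes M: "M \<in> carrier_mat n n" and sym: "transpose_mat M = M"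
  shows "\<exists>X. is_moore_penrose_inverse M X"
proof -
  obtain K where K: "K \<in> carrier_mat n n" and tK: "transpose_mat K = K" and KK: "K * K = K"
    and MK: "M * K = 0\<^sub>m n n" and det: "det (M + K) \<noteq> 0"
    using ex_kernel_projection[OF assms] .
  have KM: "K * M = 0\<^sub>m n n" using transpose_mult[OF M K] MK tK sym by simp
  have MKc: "M + K \<in> carrier_mat n n" using M K by auto
  obtain N where N: "N \<in> carrier_mat n n" and NM: "N * (M + K) = 1\<^sub>m n" "(M + K) * N = 1\<^sub>m n"
    using det_non_zero_imp_unit[OF MKc det] by (auto simp: Units_def ring_mat_def)
  have K1: "(M + K) * K = K" using MK KK by (simp add: add_mult_distrib_mat[OF M K K])
    (use K in auto)
  have K2: "K * (M + K) = K" using KM KK by (simp add: mult_add_distrib_mat[OF K M K])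
    (use K in auto)
  \<comment> \<open>\<open>M + K\<close> acts as the identity on the range of \<open>K\<close>,
    hence so does its inverse \<open>N\<close>. Therefore M N = N M = I - K, and both Penrose
    products of \<open>N - K\<close> with \<open>M\<close> equal this symmetric projection.\<close>
  have NK: "N * K = K"
    using assoc_mult_mat[OF N MKc K] K1 NM K by simp
  have KN: "K * N = K"
    using assoc_mult_mat[OF K MKc N] K2 NM K by simp
  have I: "(1\<^sub>m n - K) \<in> carrier_mat n n" and X: "N - K \<in> carrier_mat n n" using N K by auto
  have "N * M + K = 1\<^sub>m n" "M * N + K = 1\<^sub>m n"
    using NM NK KN by (simp_all add: mult_add_distrib_mat[OF N M K] add_mult_distrib_mat[OF M K N])
  then have NMI: "N * M = 1\<^sub>m n - K" "M * N = 1\<^sub>m n - K"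
    using N M K by (auto simp: mat_eq_iff algebra_simps)
  have MX: "M * (N - K) = 1\<^sub>m n - K" and XM: "(N - K) * M = 1\<^sub>m n - K"
    using K by (simp_all add: mult_minus_distrib_mat[OF M N K] minus_mult_distrib_mat[OF N K M]
      NMI MK KM) auto
  show ?thesis
    unfolding is_moore_penrose_inverse_def
  proof (intro exI conjI)
    show "M * (N - K) * M = M"
      unfolding MX using M K by (subst minus_mult_distrib_mat[OF _ K M]) (auto simp: KM)
    have "K * (N - K) = 0\<^sub>m n n"
      unfolding mult_minus_distrib_mat[OF K N K] KN KK using K by simp
    moreover have "(1\<^sub>m n - K) * (N - K) = 1\<^sub>m n * (N - K) - K * (N - K)"
      by (rule minus_mult_distrib_mat) (use K X in simp_all)
    moreover have "N - K - 0\<^sub>m n n = N - K" using N K by (intro eq_matI) auto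
    ultimately show "(N - K) * M * (N - K) = N - K"
      unfolding XM by (simp only: left_mult_one_mat[OF X])
    have "transpose_mat (1\<^sub>m n - K) = 1\<^sub>m n - K"
      using tK K by (simp add: transpose_minus[of _ n n])
    then show "transpose_mat (M * (N - K)) = M * (N - K)"
      "transpose_mat ((N - K) * M) = (N - K) * M"
      by (simp_all add: MX XM)
  qed (use X M in auto)
qed

text \<open>\<open>moore_penrose_inverse\<close> is a definite description; existence is what allows
  the Penrose equations to be drawn from an equation for it.\<close>

lemma is_moore_penrose_inverse_symmetric:
  assumes "M \<in> carrier_mat n n" "transpose_mat M = M"
  shows "is_moore_penrose_inverse M (moore_penrose_inverse M)"
  using ex_moore_penrose_inverse_symmetric[OF assms] moore_penrose_inverse_eqI by metis

section \<open>The block structure\<close>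

lemma sum_lessThan_blocks:
  fixes f :: "nat \<Rightarrow> 'a :: comm_monoid_add"
  shows "(\<Sum>k<Suc (m + m). f k) = f 0 + (\<Sum>k<m. f (Suc k)) + (\<Sum>k<m. f (Suc (m + k)))"
proof -
  have "(\<Sum>k<m + n. g k) = (\<Sum>k<m. g k) + (\<Sum>k<n. g (m + k))" for g :: "nat \<Rightarrow> 'a" and n
    by (induction n) (simp_all add: add.assoc)
  then show ?thesis by (simp add: sum.lessThan_Suc_shift add.assoc del: sum.lessThan_Suc)
qed

lemma less_blocks_cases:
  assumes "i < Suc (m + m)"
  obtains "i = 0" | k where "i = Suc k" "k < m" | k where "i = Suc (m + k)" "k < m"
proof (cases i)
  case (Suc k)
  then show ?thesis using that(2)[of k] that(3)[of "k - m"] assms by (cases "k < m") auto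
qed (use that in auto)

lemma laplacian_like_iff:
  assumes "L \<in> carrier_mat k k"
  shows "laplacian_like L \<longleftrightarrow>
    (\<forall>i<k. \<forall>j<k. L $$ (i, j) = L $$ (j, i)) \<and> (\<forall>i<k. (\<Sum>j<k. L $$ (i, j)) = 0)"
  using assms by (auto simp: laplacian_like_def symmetric_mat_def mat_eq_iff)

text \<open>Separates the Laplacian part from the rank-one part in a product; applied with D and
  with the projection P in place of \<open>M\<close>.\<close>

lemma index_mult_rank_one_update:
  assumes X: "X = (- 1 / 2) \<cdot>\<^sub>m L + \<alpha> \<cdot>\<^sub>m outer_prod w w"
    and L: "L \<in> carrier_mat k k" and w: "w \<in> carrier_vec k" and M: "M \<in> carrier_mat k k"
    and ij: "i < k" "j < k"
  shows "(M * X) $$ (i, j) =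
    (- 1 / 2) * (\<Sum>l<k. M $$ (i, l) * L $$ (l, j)) + \<alpha> * (\<Sum>l<k. M $$ (i, l) * w $ l) * w $ j"
proof -
  have Xc: "X \<in> carrier_mat k k" using X L w by auto
  have "(M * X) $$ (i, j) = (\<Sum>l<k. (- 1 / 2) * (M $$ (i, l) * L $$ (l, j))
      + \<alpha> * (M $$ (i, l) * w $ l) * w $ j)"
    unfolding index_mult_mat_sum[OF M Xc ij]
    using L w ij by (intro sum.cong) (auto simp: X algebra_simps)
  then show ?thesis by (simp only: sum.distrib sum_distrib_left sum_distrib_right)
qed

text \<open>Associativity (M M') f = M (M' f), with \<open>f\<close> an index function instead of a
  vector.\<close>

lemma sum_mult_mat_apply:
  fixes M M' :: "real mat"
  assumes "M \<in> carrier_mat k k" "M' \<in> carrier_mat k k" "i < k"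
  shows "(\<Sum>j<k. (M * M') $$ (i, j) * f j) = (\<Sum>l<k. M $$ (i, l) * (\<Sum>j<k. M' $$ (l, j) * f j))"
proof -
  have "(\<Sum>j<k. (M * M') $$ (i, j) * f j) = (\<Sum>j<k. \<Sum>l<k. M $$ (i, l) * M' $$ (l, j) * f j)"
    using assms by (intro sum.cong) (simp_all add: index_mult_mat_sum[of _ k k _ k] sum_distrib_right del: index_mult_mat)
  also have "\<dots> = (\<Sum>l<k. M $$ (i, l) * (\<Sum>j<k. M' $$ (l, j) * f j))"
    by (subst sum.swap) (simp add: sum_distrib_left mult.assoc)
  finally show ?thesis .
qed

text \<open>Collects what the linear algebra takes from the graph, with \<open>m\<close> standing
  for n - 1. Indices 0, 1..m and m+1..2m belong to the hub, the rim and the pendant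
  vertices.\<close>

locale helm_blocks =
  fixes m :: nat and S D :: "real mat"
  assumes m_pos: "m > 0"
    and S_carrier: "S \<in> carrier_mat m m"
    and S_sym: "i < m \<Longrightarrow> j < m \<Longrightarrow> S $$ (i, j) = S $$ (j, i)"
    and S_row_sum: "i < m \<Longrightarrow> (\<Sum>j<m. S $$ (i, j)) = 4"
    and D_carrier: "D \<in> carrier_mat (Suc (m + m)) (Suc (m + m))"
    and D_entries: "D $$ (0, 0) = 0"
      "i < m \<Longrightarrow> D $$ (0, Suc i) = 1"
      "i < m \<Longrightarrow> D $$ (0, Suc (m + i)) = 2"
      "i < m \<Longrightarrow> D $$ (Suc i, 0) = 1"
      "i < m \<Longrightarrow> j < m \<Longrightarrow> D $$ (Suc i, Suc j) = 2 - S $$ (i, j)"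
      "i < m \<Longrightarrow> j < m \<Longrightarrow> D $$ (Suc i, Suc (m + j)) = 3 - S $$ (i, j)"
      "i < m \<Longrightarrow> D $$ (Suc (m + i), 0) = 2"
      "i < m \<Longrightarrow> j < m \<Longrightarrow> D $$ (Suc (m + i), Suc j) = 3 - S $$ (i, j)"
      "i < m \<Longrightarrow> j < m \<Longrightarrow> D $$ (Suc (m + i), Suc (m + j))
        = 4 - S $$ (i, j) - (if i = j then 2 else 0)"
begin

lemma D_sym: "transpose_mat D = D"
proof (rule eq_matI)
  fix i j assume "i < dim_row D" "j < dim_col D"
  then show "transpose_mat D $$ (i, j) = D $$ (i, j)"
    using D_carrier
    by (auto elim!: less_blocks_cases[of i m] less_blocks_cases[of j m] simp: D_entries S_sym)
qed (use D_carrier in auto)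

section \<open>The action of D, its kernel, and the vector w\<close>

lemma D_apply:
  fixes f :: "nat \<Rightarrow> real"
  defines "s \<equiv> \<Sum>k<m. f (Suc k)" and "t \<equiv> \<Sum>k<m. f (Suc (m + k))"
  shows "(\<Sum>k<Suc (m + m). D $$ (0, k) * f k) = s + 2 * t"
    and "i < m \<Longrightarrow> (\<Sum>k<Suc (m + m). D $$ (Suc i, k) * f k) = f 0 + 2 * s + 3 * t
      - (\<Sum>k<m. S $$ (i, k) * f (Suc k)) - (\<Sum>k<m. S $$ (i, k) * f (Suc (m + k)))"
    and "i < m \<Longrightarrow> (\<Sum>k<Suc (m + m). D $$ (Suc (m + i), k) * f k) = 2 * f 0 + 3 * s + 4 * t
      - (\<Sum>k<m. S $$ (i, k) * f (Suc k)) - (\<Sum>k<m. S $$ (i, k) * f (Suc (m + k)))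
      - 2 * f (Suc (m + i))"
  unfolding sum_lessThan_blocks s_def t_def
  by (simp_all add: D_entries sum_distrib_left left_diff_distrib sum_subtractf
      if_distrib[of "\<lambda>x. x * _"] cong: if_cong)

lemma S_col_sum: "j < m \<Longrightarrow> (\<Sum>i<m. S $$ (i, j)) = 4"
  using S_row_sum[of j] by (simp add: S_sym)

lemma sum_S_apply: "(\<Sum>i<m. \<Sum>k<m. S $$ (i, k) * f k) = 4 * (\<Sum>k<m. f k)"
  by (subst sum.swap) (simp add: sum_distrib_left S_col_sum flip: sum_distrib_right)

text \<open>The second and third block rows contain the same S-terms, so their difference is free of
  S. Summing over \<open>i\<close> replaces the S-terms by multiples of the block sums, because the
  columns of S sum to 4. What remains is a linear system in \<open>f 0\<close>, s and t with only
  the zero solution.\<close>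

lemma D_kernel:
  fixes f :: "nat \<Rightarrow> real"
  assumes ker: "\<And>i. i < Suc (m + m) \<Longrightarrow> (\<Sum>k<Suc (m + m). D $$ (i, k) * f k) = 0"
  shows "f 0 = 0" "(\<Sum>k<m. f (Suc k)) = 0" "i < m \<Longrightarrow> f (Suc (m + i)) = 0"
    "i < m \<Longrightarrow> (\<Sum>k<m. S $$ (i, k) * f (Suc k)) = 0"
proof -
  define s t where "s = (\<Sum>k<m. f (Suc k))" and "t = (\<Sum>k<m. f (Suc (m + k)))"
  let ?x = "\<lambda>i. \<Sum>k<m. S $$ (i, k) * f (Suc k)" and ?y = "\<lambda>i. \<Sum>k<m. S $$ (i, k) * f (Suc (m + k))"
  have st: "s + 2 * t = 0"
    using ker[of 0] by (simp only: D_apply s_def t_def)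
  have row1: "f 0 + 2 * s + 3 * t - ?x i - ?y i = 0" if "i < m" for i
    using ker[of "Suc i"] that by (simp only: D_apply s_def t_def)
  have row2: "2 * f 0 + 3 * s + 4 * t - ?x i - ?y i - 2 * f (Suc (m + i)) = 0" if "i < m" for i
    using ker[of "Suc (m + i)"] that by (simp only: D_apply s_def t_def)
  have diff: "2 * f (Suc (m + i)) = f 0 + s + t" if "i < m" for i
    using row1[OF that] row2[OF that] by linarith
  have "(\<Sum>i<m. f 0 + 2 * s + 3 * t - ?x i - ?y i) = 0" using row1 by simp
  then have sum1: "m * (f 0 + 2 * s + 3 * t) - 4 * s - 4 * t = 0"
    by (simp add: sum_subtractf sum_S_apply s_def t_def)
  have "(\<Sum>i<m. 2 * f (Suc (m + i))) = (\<Sum>i<m. f 0 + s + t)" using diff by simp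
  then have sum2: "2 * t = m * (f 0 + s + t)"
    by (simp add: t_def flip: sum_distrib_left)
  have s: "s = - 2 * t" using st by simp
  \<comment> \<open>Substituting the second equation into the first gives 6 t = 0.\<close>
  have "m * (f 0 - t) + 4 * t = 0" "m * (f 0 - t) = 2 * t"
    using sum1 sum2 unfolding s by (simp_all add: algebra_simps)
  then have t0: "t = 0" and "m * f 0 = 0" by simp_all
  then have f0: "f 0 = 0" and s0: "s = 0" using m_pos s by auto
  then show "f 0 = 0" "(\<Sum>k<m. f (Suc k)) = 0" by (simp_all add: s_def)
  show y0: "f (Suc (m + i)) = 0" if "i < m" for i using diff[OF that] f0 s0 t0 by simp
  show "?x i = 0" if "i < m" for i
    using row1[OF that] y0 f0 s0 t0 by simp
qed

text \<open>Up to scale this is the solution of D x = e that is constant on the rim and on the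
  pendant vertices; the scale makes its entries sum to 1.\<close>

definition wt :: "real vec" where
  "wt = vec (Suc (m + m)) (\<lambda>i. if i = 0 then (4 - real m) / 4 else if i \<le> m then - 1 / 4 else 1 / 2)"

lemma wt_carrier: "wt \<in> carrier_vec (Suc (m + m))"
  by (simp add: wt_def)

lemma wt_entries [simp]:
  "wt $ 0 = (4 - real m) / 4" "i < m \<Longrightarrow> wt $ Suc i = - 1 / 4" "i < m \<Longrightarrow> wt $ Suc (m + i) = 1 / 2"
  by (simp_all add: wt_def)

lemma sum_wt: "(\<Sum>k<Suc (m + m). wt $ k) = 1"
  unfolding sum_lessThan_blocks by simp (simp add: field_simps)

lemma D_wt: "i < Suc (m + m) \<Longrightarrow> (\<Sum>k<Suc (m + m). D $$ (i, k) * wt $ k) = 3 * real m / 4"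
proof (erule less_blocks_cases)
  show "(\<Sum>k<Suc (m + m). D $$ (i, k) * wt $ k) = 3 * real m / 4" if "i = 0"
    unfolding that D_apply by simp
  show "(\<Sum>k<Suc (m + m). D $$ (i, k) * wt $ k) = 3 * real m / 4" if i: "i = Suc l" "l < m" for l
    unfolding i(1) D_apply(2)[OF i(2)] using S_row_sum[OF i(2)]
    by (simp add: sum_negf flip: sum_divide_distrib) (simp add: field_simps)
  show "(\<Sum>k<Suc (m + m). D $$ (i, k) * wt $ k) = 3 * real m / 4" if i: "i = Suc (m + l)" "l < m" for l
    unfolding i(1) D_apply(3)[OF i(2)] using S_row_sum[OF i(2)] i(2)
    by (simp add: sum_negf flip: sum_divide_distrib) (simp add: field_simps)
qed

text \<open>The conditions are given as entry sums over \<open>m\<close>. They make D X a symmetric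
  matrix P that fixes D and X from the left; symmetry of X then gives X D = P by transposition, and
  the Penrose equations follow.\<close>

lemma moore_penrose_of_blocks:
  assumes A: "A \<in> carrier_mat m m" and B: "B \<in> carrier_mat m m"
    and A_sym: "\<And>i j. i < m \<Longrightarrow> j < m \<Longrightarrow> A $$ (i, j) = A $$ (j, i)"
    and B_sym: "\<And>i j. i < m \<Longrightarrow> j < m \<Longrightarrow> B $$ (i, j) = B $$ (j, i)"
    and L: "L \<in> carrier_mat (Suc (m + m)) (Suc (m + m))"
    and L_entries: "L $$ (0, 0) = m / 2"
      "\<And>i. i < m \<Longrightarrow> L $$ (0, Suc i) = - 1 / 2"
      "\<And>i. i < m \<Longrightarrow> L $$ (0, Suc (m + i)) = 0"
      "\<And>i. i < m \<Longrightarrow> L $$ (Suc i, 0) = - 1 / 2"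
      "\<And>i j. i < m \<Longrightarrow> j < m \<Longrightarrow> L $$ (Suc i, Suc j) = A $$ (i, j)"
      "\<And>i j. i < m \<Longrightarrow> j < m \<Longrightarrow> L $$ (Suc i, Suc (m + j)) = B $$ (i, j)"
      "\<And>i. i < m \<Longrightarrow> L $$ (Suc (m + i), 0) = 0"
      "\<And>i j. i < m \<Longrightarrow> j < m \<Longrightarrow> L $$ (Suc (m + i), Suc j) = B $$ (j, i)"
      "\<And>i j. i < m \<Longrightarrow> j < m \<Longrightarrow> L $$ (Suc (m + i), Suc (m + j)) = (if i = j then 1 else 0)"
    and A_row: "\<And>i. i < m \<Longrightarrow> (\<Sum>k<m. A $$ (i, k)) = 3 / 2"
    and B_row: "\<And>i. i < m \<Longrightarrow> (\<Sum>k<m. B $$ (i, k)) = - 1"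
    and BS: "\<And>i j. i < m \<Longrightarrow> j < m \<Longrightarrow> (\<Sum>k<m. B $$ (i, k) * S $$ (k, j)) = - S $$ (i, j)"
    and BA: "\<And>i j. i < m \<Longrightarrow> j < m \<Longrightarrow> (\<Sum>k<m. B $$ (i, k) * A $$ (k, j)) = - A $$ (i, j)"
    and BB: "\<And>i j. i < m \<Longrightarrow> j < m \<Longrightarrow> (\<Sum>k<m. B $$ (i, k) * B $$ (k, j)) = - B $$ (i, j)"
    and ABS: "\<And>i j. i < m \<Longrightarrow> j < m \<Longrightarrow>
      (\<Sum>k<m. (A $$ (i, k) + B $$ (i, k)) * S $$ (k, j)) = - 2 * B $$ (i, j)"
  shows "is_moore_penrose_inverse D ((- 1 / 2) \<cdot>\<^sub>m L + (4 / (3 * real m)) \<cdot>\<^sub>m outer_prod wt wt)"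
proof -
  let ?N = "Suc (m + m)"
  define X where "X = (- 1 / 2) \<cdot>\<^sub>m L + (4 / (3 * real m)) \<cdot>\<^sub>m outer_prod wt wt"
  \<comment> \<open>The expected value diag(1, -B, I) of D X.\<close>
  define P where "P = mat ?N ?N (\<lambda>(i, j). if 0 < i \<and> i \<le> m \<and> 0 < j \<and> j \<le> m then - B $$ (i - 1, j - 1)
    else if i = j then 1 else 0 :: real)"
  have Xc: "X \<in> carrier_mat ?N ?N" and Pc: "P \<in> carrier_mat ?N ?N"
    using L wt_carrier by (auto simp: X_def P_def)
  have P_entries: "P $$ (0, 0) = 1"
      "\<And>i. i < m \<Longrightarrow> P $$ (0, Suc i) = 0"
      "\<And>i. i < m \<Longrightarrow> P $$ (0, Suc (m + i)) = 0"
      "\<And>i. i < m \<Longrightarrow> P $$ (Suc i, 0) = 0"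
      "\<And>i j. i < m \<Longrightarrow> j < m \<Longrightarrow> P $$ (Suc i, Suc j) = - B $$ (i, j)"
      "\<And>i j. i < m \<Longrightarrow> j < m \<Longrightarrow> P $$ (Suc i, Suc (m + j)) = 0"
      "\<And>i. i < m \<Longrightarrow> P $$ (Suc (m + i), 0) = 0"
      "\<And>i j. i < m \<Longrightarrow> j < m \<Longrightarrow> P $$ (Suc (m + i), Suc j) = 0"
      "\<And>i j. i < m \<Longrightarrow> j < m \<Longrightarrow> P $$ (Suc (m + i), Suc (m + j)) = (if i = j then 1 else 0)"
    by (auto simp: P_def)
  have P_sym: "transpose_mat P = P"
  proof (rule eq_matI)
    fix i j assume "i < dim_row P" "j < dim_col P"
    then show "transpose_mat P $$ (i, j) = P $$ (i, j)"
      using Pc B_sym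
      by (auto elim!: less_blocks_cases[of i m] less_blocks_cases[of j m] simp: P_entries)
  qed (use Pc in auto)
  have P_apply: "(\<Sum>k<?N. P $$ (0, k) * f k) = f 0"
      "i < m \<Longrightarrow> (\<Sum>k<?N. P $$ (Suc i, k) * f k) = - (\<Sum>k<m. B $$ (i, k) * f (Suc k))"
      "i < m \<Longrightarrow> (\<Sum>k<?N. P $$ (Suc (m + i), k) * f k) = f (Suc (m + i))" for f i
    unfolding sum_lessThan_blocks
    by (simp_all add: P_entries sum_negf if_distrib[of "\<lambda>x. x * _"] cong: if_cong)
  \<comment> \<open>\<open>P\<close> differs from the identity only in its middle block, so only the
    rim rows of \<open>M\<close> have to be checked, and there \<open>B\<close> must act as
    -1.\<close>
  have P_fix: "P * M = M"
    if M: "M \<in> carrier_mat ?N ?N"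
      and fix1: "\<And>i j. i < m \<Longrightarrow> j < ?N \<Longrightarrow> (\<Sum>k<m. B $$ (i, k) * M $$ (Suc k, j)) = - M $$ (Suc i, j)"
    for M
  proof (rule eq_matI)
    fix i j assume "i < dim_row M" "j < dim_col M"
    then have ij: "i < ?N" "j < ?N" using M by auto
    show "(P * M) $$ (i, j) = M $$ (i, j)"
      unfolding index_mult_mat_sum[OF Pc M ij]
      using ij(1) by (rule less_blocks_cases) (use fix1 ij(2) in \<open>simp_all only: P_apply minus_minus\<close>)
  qed (use M Pc in auto)
  have A_col: "(\<Sum>k<m. A $$ (k, j)) = 3 / 2" and B_col: "(\<Sum>k<m. B $$ (k, j)) = - 1" if "j < m" for j
    using A_row[OF that] B_row[OF that] that by (simp_all add: A_sym[of _ j] B_sym[of _ j])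
  have B_c: "(\<Sum>k<m. B $$ (i, k) * c) = - c" if "i < m" for i c
    using B_row[OF that] by (simp flip: sum_distrib_right)
  have SB: "(\<Sum>k<m. S $$ (i, k) * B $$ (k, j)) = - S $$ (i, j)" if "i < m" "j < m" for i j
    using BS[OF that(2,1)] that by (simp add: S_sym[of _ i] B_sym[of _ j] S_sym[of j] mult.commute)
  have SB': "(\<Sum>k<m. S $$ (i, k) * B $$ (j, k)) = - S $$ (i, j)" if "i < m" "j < m" for i j
    using SB[OF that] that by (simp add: B_sym[of _ j])
  \<comment> \<open>Condition (vi) transposed reads S A + S B = -2B; inserting S B = -S leaves S A =
    S - 2B.\<close>
  have SA: "(\<Sum>k<m. S $$ (i, k) * A $$ (k, j)) = S $$ (i, j) - 2 * B $$ (i, j)" if "i < m" "j < m" for i j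
  proof -
    have "(\<Sum>k<m. S $$ (i, k) * A $$ (k, j)) + (\<Sum>k<m. S $$ (i, k) * B $$ (k, j)) =
        (\<Sum>k<m. (A $$ (j, k) + B $$ (j, k)) * S $$ (k, i))"
      using that by (simp add: S_sym[of _ i] B_sym[of _ j] A_sym[of _ j] algebra_simps sum.distrib)
    then show ?thesis using ABS[OF that(2,1)] SB[OF that] B_sym[OF that] by simp
  qed
  have DL: "(\<Sum>k<?N. D $$ (i, k) * L $$ (k, j)) = 2 * wt $ j - 2 * P $$ (i, j)"
    if ij: "i < ?N" "j < ?N" for i j
    using ij(1)
  proof (rule less_blocks_cases)
    assume "i = 0"
    show ?thesis unfolding \<open>i = 0\<close> D_apply using ij(2)
      by (rule less_blocks_cases; simp add: L_entries P_entries A_col B_col B_row;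
          (simp add: field_simps)?)
  next
    fix l assume i: "i = Suc l" "l < m"
    show ?thesis unfolding i(1) D_apply(2)[OF i(2)] using ij(2)
      by (rule less_blocks_cases; simp add: L_entries P_entries A_col B_col B_row S_row_sum SA SB SB' i sum_negf
            if_distrib[of "\<lambda>x. _ * x"] flip: sum_divide_distrib cong: if_cong;
          (simp add: field_simps i B_sym)?)
  next
    fix l assume i: "i = Suc (m + l)" "l < m"
    show ?thesis unfolding i(1) D_apply(3)[OF i(2)] using ij(2)
      by (rule less_blocks_cases; simp add: L_entries P_entries A_col B_col B_row S_row_sum SA SB SB' i sum_negf
            if_distrib[of "\<lambda>x. _ * x"] flip: sum_divide_distrib cong: if_cong;
          (simp add: field_simps i B_sym)?)
  qed
  \<comment> \<open>The part -L/2 contributes P - e w'. In the rank-one part the factor 4/(3m)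
    cancels D w = (3m/4) e, which returns e w'.\<close>
  have DX: "D * X = P"
  proof (rule eq_matI)
    fix i j assume "i < dim_row P" "j < dim_col P"
    then have ij: "i < ?N" "j < ?N" using Pc by auto
    show "(D * X) $$ (i, j) = P $$ (i, j)"
      unfolding index_mult_rank_one_update[OF X_def L wt_carrier D_carrier ij] DL[OF ij] D_wt[OF ij(1)]
      using m_pos by (simp add: diff_divide_distrib)
  qed (use Xc D_carrier Pc in auto)
  have PD: "P * D = D"
  proof (rule P_fix[OF D_carrier])
    fix i j assume i: "i < m" and "j < ?N"
    then show "(\<Sum>k<m. B $$ (i, k) * D $$ (Suc k, j)) = - D $$ (Suc i, j)"
      by (elim less_blocks_cases)
        (simp_all add: D_entries right_diff_distrib sum_subtractf B_c BS B_row)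
  qed
  have PX: "P * X = X"
  proof (rule P_fix[OF Xc])
    fix i j assume i: "i < m" and j: "j < ?N"
    \<comment> \<open>On the rim \<open>wt\<close> is -1/4, so the rank-one part is constant down
      the rim rows of each column, with factor (4/(3m)) (-1/4) = -1/(3m).\<close>
    have X_entry: "X $$ (Suc k, j) = (- 1 / 2) * L $$ (Suc k, j) - (wt $ j / (3 * real m))" if "k < m" for k
      using that j L wt_carrier by (simp add: X_def)
    have BL: "(\<Sum>k<m. B $$ (i, k) * L $$ (Suc k, j)) = - L $$ (Suc i, j)"
      using j by (rule less_blocks_cases) (use i in \<open>simp_all add: L_entries B_row BA BB sum_negf
        if_distrib[of "\<lambda>x. _ * x"] flip: sum_divide_distrib cong: if_cong\<close>)
    have "(\<Sum>k<m. B $$ (i, k) * X $$ (Suc k, j)) =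
      (- 1 / 2) * (\<Sum>k<m. B $$ (i, k) * L $$ (Suc k, j)) - (\<Sum>k<m. B $$ (i, k) * (wt $ j / (3 * real m)))"
      by (simp add: X_entry right_diff_distrib sum_subtractf sum_distrib_left sum_negf mult.left_commute)
    then show "(\<Sum>k<m. B $$ (i, k) * X $$ (Suc k, j)) = - X $$ (Suc i, j)"
      unfolding BL B_c[OF i] X_entry[OF i] by simp
  qed
  have X_sym: "transpose_mat X = X"
  proof (rule eq_matI)
    fix i j assume "i < dim_row X" "j < dim_col X"
    then have ij: "i < ?N" "j < ?N" using Xc by auto
    have "L $$ (j, i) = L $$ (i, j)"
      using ij by (elim less_blocks_cases) (simp_all add: L_entries A_sym)
    then show "transpose_mat X $$ (i, j) = X $$ (i, j)"
      using ij Xc L wt_carrier by (simp add: X_def)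
  qed (use Xc in auto)
  have XD: "X * D = P"
    using transpose_mult[OF D_carrier Xc] DX P_sym X_sym D_sym by simp
  have "X * D * X = X" unfolding XD by (rule PX)
  then show ?thesis
    unfolding X_def[symmetric] is_moore_penrose_inverse_def DX
    using XD PD P_sym D_carrier Xc by simp
qed

text \<open>Here \<open>A\<close> and \<open>B\<close> are index functions reading off the blocks of
  \<open>L\<close>. The kernel of D determines P = D X outside its middle block; the equations for D
  L and P L then yield all entries and relations.\<close>

lemma blocks_of_moore_penrose:
  assumes L: "L \<in> carrier_mat (Suc (m + m)) (Suc (m + m))"
    and lap: "laplacian_like L"
    and w: "w \<in> carrier_vec (Suc (m + m))" and sum_w: "(\<Sum>i<Suc (m + m). w $ i) = 1"
    and mp: "is_moore_penrose_inverse D ((- 1 / 2) \<cdot>\<^sub>m L + \<alpha> \<cdot>\<^sub>m outer_prod w w)"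
  defines "A \<equiv> \<lambda>i j. L $$ (Suc i, Suc j)" and "B \<equiv> \<lambda>i j. L $$ (Suc i, Suc (m + j))"
  shows "L $$ (0, 0) = m / 2"
    "\<And>i. i < m \<Longrightarrow> L $$ (0, Suc i) = - 1 / 2"
    "\<And>i. i < m \<Longrightarrow> L $$ (0, Suc (m + i)) = 0"
    "\<And>i j. i < m \<Longrightarrow> j < m \<Longrightarrow> L $$ (Suc (m + i), Suc (m + j)) = (if i = j then 1 else 0)"
    "\<And>i j. i < m \<Longrightarrow> j < m \<Longrightarrow> B i j = B j i"
    "\<And>i. i < m \<Longrightarrow> (\<Sum>k<m. A i k) = 3 / 2"
    "\<And>i. i < m \<Longrightarrow> (\<Sum>k<m. B i k) = - 1"
    "\<And>i j. i < m \<Longrightarrow> j < m \<Longrightarrow> (\<Sum>k<m. B i k * S $$ (k, j)) = - S $$ (i, j)"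
    "\<And>i j. i < m \<Longrightarrow> j < m \<Longrightarrow> (\<Sum>k<m. B i k * A k j) = - A i j"
    "\<And>i j. i < m \<Longrightarrow> j < m \<Longrightarrow> (\<Sum>k<m. B i k * B k j) = - B i j"
    "\<And>i j. i < m \<Longrightarrow> j < m \<Longrightarrow> (\<Sum>k<m. (A i k + B i k) * S $$ (k, j)) = - 2 * B i j"
proof -
  let ?N = "Suc (m + m)"
  have L_sym: "\<And>i j. i < ?N \<Longrightarrow> j < ?N \<Longrightarrow> L $$ (i, j) = L $$ (j, i)"
    and L_row: "\<And>i. i < ?N \<Longrightarrow> (\<Sum>j<?N. L $$ (i, j)) = 0"
    using lap unfolding laplacian_like_iff[OF L] by blast+
  define X where "X = (- 1 / 2) \<cdot>\<^sub>m L + \<alpha> \<cdot>\<^sub>m outer_prod w w"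
  define P where "P = D * X"
  note X_mult = index_mult_rank_one_update[OF X_def L w]
  have Xc: "X \<in> carrier_mat ?N ?N" and Pc: "P \<in> carrier_mat ?N ?N"
    using L w D_carrier by (auto simp: X_def P_def)
  have X_entry: "X $$ (i, j) = (- 1 / 2) * L $$ (i, j) + \<alpha> * w $ i * w $ j"
    if "i < ?N" "j < ?N" for i j
    using that L w by (simp add: X_def)
  have X_sym: "transpose_mat X = X"
    using Xc L_sym by (intro eq_matI) (auto simp: X_entry)
  have P_sym: "transpose_mat P = P" and DXD: "P * D = D" and XDX: "X * D * X = X"
    using mp unfolding is_moore_penrose_inverse_def X_def[symmetric] P_def by auto
  have XD: "X * D = P"
    using transpose_mult[OF D_carrier Xc] P_sym X_sym D_sym by (simp add: P_def)
  have PX: "P * X = X" using XDX by (simp add: XD)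
  have DP: "D * P = D"
    using transpose_mult[OF Pc D_carrier] P_sym D_sym DXD by simp
  have P_sym': "P $$ (i, j) = P $$ (j, i)" if "i < ?N" "j < ?N" for i j
    using P_sym Pc that by (metis carrier_matD index_transpose_mat(1))
  \<comment> \<open>\<open>K j\<close> is column \<open>j\<close> of I - P. Since D P = D, it lies
    in the kernel of D, so \<open>D_kernel\<close> applies.\<close>
  define K where "K j k = (if k = j then 1 else 0) - P $$ (k, j)" for j k
  have K_ker: "(\<Sum>k<?N. D $$ (i, k) * K j k) = 0" if "i < ?N" "j < ?N" for i j
  proof -
    have "(\<Sum>k<?N. D $$ (i, k) * K j k) = D $$ (i, j) - (D * P) $$ (i, j)"
      unfolding index_mult_mat_sum[OF D_carrier Pc that] K_def
      using that(2) by (simp add: right_diff_distrib sum_subtractf if_distrib[of "\<lambda>x. _ * x"]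
        cong: if_cong del: sum.lessThan_Suc)
    then show ?thesis by (simp add: DP)
  qed
  have K0: "K j 0 = 0" and K1: "(\<Sum>k<m. K j (Suc k)) = 0" if "j < ?N" for j
    using D_kernel(1,2)[of "K j"] K_ker that by auto
  have K2: "K j (Suc (m + i)) = 0" and KS: "(\<Sum>k<m. S $$ (i, k) * K j (Suc k)) = 0"
    if "i < m" "j < ?N" for i j
    using D_kernel(3,4)[of "K j" i] K_ker that by auto
  \<comment> \<open>P fixes each vector that is constant on the rim, because the columns of I - P
    live on the rim and sum to 0 there. This covers e and \<open>wt\<close>, and \<open>w\<close>
    once it is known to equal \<open>wt\<close>.\<close>
  have P_col_fix: "(\<Sum>k<?N. P $$ (i, k) * f k) = f i"
    if i: "i < ?N" and f: "\<And>k. k < m \<Longrightarrow> f (Suc k) = c" for i c and f :: "nat \<Rightarrow> real"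
  proof -
    have "(\<Sum>k<?N. K i k * f k) = 0"
      unfolding sum_lessThan_blocks using K0 K1 K2 i
      by (simp add: f flip: sum_distrib_right)
    then have "(\<Sum>k<?N. P $$ (k, i) * f k) = f i"
      using i by (simp add: K_def left_diff_distrib sum_subtractf if_distrib[of "\<lambda>x. x * _"]
        cong: if_cong del: sum.lessThan_Suc)
    moreover have "(\<Sum>k<?N. P $$ (k, i) * f k) = (\<Sum>k<?N. P $$ (i, k) * f k)"
      using i by (intro sum.cong) (auto simp: P_sym'[of _ i])
    ultimately show ?thesis by simp
  qed
  have X_row: "(\<Sum>j<?N. X $$ (i, j)) = \<alpha> * w $ i" if "i < ?N" for i
  proof -
    have "(\<Sum>j<?N. X $$ (i, j)) = (\<Sum>j<?N. (- 1 / 2) * L $$ (i, j) + \<alpha> * w $ i * w $ j)"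
      using that by (intro sum.cong) (simp_all add: X_entry)
    then show ?thesis
      using that by (simp add: sum_subtractf L_row sum_w flip: sum_distrib_left sum_divide_distrib
        del: sum.lessThan_Suc)
  qed
  \<comment> \<open>e = P e = D (X e), and X e = \<alpha> w because L e = 0 and e'w = 1.\<close>
  have Dw: "\<alpha> * (\<Sum>k<?N. D $$ (i, k) * w $ k) = 1" if "i < ?N" for i
  proof -
    have "1 = (\<Sum>j<?N. P $$ (i, j) * 1)" using P_col_fix[OF that, of "\<lambda>_. 1" 1] by simp
    also have "\<dots> = (\<Sum>l<?N. D $$ (i, l) * (\<Sum>j<?N. X $$ (l, j) * 1))"
      unfolding P_def by (rule sum_mult_mat_apply[OF D_carrier Xc that])
    also have "\<dots> = (\<Sum>l<?N. D $$ (i, l) * (\<alpha> * w $ l))"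
      by (intro sum.cong) (simp_all only: lessThan_iff mult_1_right X_row)
    also have "\<dots> = \<alpha> * (\<Sum>k<?N. D $$ (i, k) * w $ k)"
      by (simp only: sum_distrib_left mult.left_commute)
    finally show ?thesis by simp
  qed
  \<comment> \<open>wt = P wt = X (D wt) = (3m/4) X e.\<close>
  have wt_w: "wt $ i = 3 * real m / 4 * \<alpha> * w $ i" if "i < ?N" for i
  proof -
    have "wt $ i = (\<Sum>j<?N. P $$ (i, j) * wt $ j)"
      using P_col_fix[OF that, of "\<lambda>k. wt $ k" "- 1 / 4"] by simp
    also have "\<dots> = (\<Sum>l<?N. X $$ (i, l) * (\<Sum>j<?N. D $$ (l, j) * wt $ j))"
      unfolding XD[symmetric] by (rule sum_mult_mat_apply[OF Xc D_carrier that])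
    also have "\<dots> = (\<Sum>l<?N. X $$ (i, l) * (3 * real m / 4))"
      by (intro sum.cong) (simp_all only: lessThan_iff D_wt)
    also have "\<dots> = \<alpha> * w $ i * (3 * real m / 4)"
      by (simp only: X_row[OF that] flip: sum_distrib_right)
    finally show ?thesis by simp
  qed
  \<comment> \<open>Both vectors have entry sum 1, so the proportionality factor is 1.\<close>
  have "1 = (\<Sum>i<?N. wt $ i)" by (rule sum_wt[symmetric])
  also have "\<dots> = (\<Sum>i<?N. 3 * real m / 4 * \<alpha> * w $ i)"
    by (rule sum.cong) (simp_all only: wt_w lessThan_iff)
  also have "\<dots> = 3 * real m / 4 * \<alpha>"
    by (simp only: sum_w mult_1_right flip: sum_distrib_left)
  finally have w_wt: "w $ i = wt $ i" if "i < ?N" for i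
    using wt_w[OF that] by simp
  have DL: "(\<Sum>k<?N. D $$ (i, k) * L $$ (k, j)) = 2 * wt $ j - 2 * P $$ (i, j)"
    if "i < ?N" "j < ?N" for i j
    using X_mult[OF D_carrier that] Dw[OF that(1)] w_wt[OF that(2)] by (simp add: P_def[symmetric])
  \<comment> \<open>P X = X and P w = w; the rank-one part therefore cancels.\<close>
  have PL: "(\<Sum>k<?N. P $$ (i, k) * L $$ (k, j)) = L $$ (i, j)" if "i < ?N" "j < ?N" for i j
  proof -
    have "(\<Sum>k<?N. P $$ (i, k) * w $ k) = w $ i"
      using P_col_fix[OF that(1), of "\<lambda>k. w $ k" "- 1 / 4"] w_wt by simp
    then show ?thesis
      using X_mult[OF Pc that] X_entry[OF that] by (simp add: PX)
  qed
  have P2: "P $$ (Suc (m + i), j) = (if Suc (m + i) = j then 1 else 0)" if "i < m" "j < ?N" for i j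
    using K2[OF that] by (simp add: K_def)
  have P0: "P $$ (0, j) = (if j = 0 then 1 else 0)" if "j < ?N" for j
    using K0[OF that] by (simp add: K_def)
  have P10: "P $$ (Suc i, 0) = 0" and P12: "j < m \<Longrightarrow> P $$ (Suc i, Suc (m + j)) = 0" if "i < m" for i j
    using that P0[of "Suc i"] P2[of j "Suc i"] P_sym'[of "Suc i"] by auto
  have P1_sum: "(\<Sum>k<m. P $$ (Suc k, Suc j)) = 1" if "j < m" for j
    using K1[of "Suc j"] that by (simp add: K_def sum_subtractf)
  have SP: "(\<Sum>k<m. S $$ (i, k) * P $$ (Suc k, Suc j)) = S $$ (i, j)" if "i < m" "j < m" for i j
    using KS[of i "Suc j"] that
    by (simp add: K_def right_diff_distrib sum_subtractf if_distrib[of "\<lambda>x. _ * x"] cong: if_cong)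
  define s t where "s j = (\<Sum>k<m. L $$ (Suc k, j))" and "t j = (\<Sum>k<m. L $$ (Suc (m + k), j))" for j
  have col: "L $$ (0, j) + s j + t j = 0" if "j < ?N" for j
  proof -
    have "(\<Sum>k<?N. L $$ (k, j)) = (\<Sum>k<?N. L $$ (j, k))"
      using that by (intro sum.cong) (auto simp: L_sym[of _ j])
    then show ?thesis
      using L_row[OF that] unfolding sum_lessThan_blocks s_def t_def by simp
  qed
  have e0: "s j + 2 * t j = 2 * wt $ j - 2 * P $$ (0, j)" if "j < ?N" for j
    using DL[of 0 j] that by (simp only: D_apply s_def t_def zero_less_Suc)
  have e1: "L $$ (0, j) + 2 * s j + 3 * t j - (\<Sum>k<m. S $$ (i, k) * L $$ (Suc k, j))
      - (\<Sum>k<m. S $$ (i, k) * L $$ (Suc (m + k), j)) = 2 * wt $ j - 2 * P $$ (Suc i, j)"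
    if "i < m" "j < ?N" for i j
    using DL[of "Suc i" j] that unfolding D_apply(2)[OF that(1)] s_def t_def by simp
  have e2: "2 * L $$ (0, j) + 3 * s j + 4 * t j - (\<Sum>k<m. S $$ (i, k) * L $$ (Suc k, j))
      - (\<Sum>k<m. S $$ (i, k) * L $$ (Suc (m + k), j)) - 2 * L $$ (Suc (m + i), j)
      = 2 * wt $ j - 2 * P $$ (Suc (m + i), j)"
    if "i < m" "j < ?N" for i j
    using DL[of "Suc (m + i)" j] that unfolding D_apply(3)[OF that(1)] s_def t_def by simp
  \<comment> \<open>Subtracting \<open>e2\<close> from \<open>e1\<close> removes the S-terms, and
    the vanishing column sum of \<open>L\<close> removes the rest. The pendant rows of
    \<open>L\<close> are thus differences of rows of P, whence B = -Q for the middle block Q of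
    P.\<close>
  have L2: "L $$ (Suc (m + i), j) = P $$ (Suc (m + i), j) - P $$ (Suc i, j)" if "i < m" "j < ?N" for i j
    using e1[OF that] e2[OF that] col[OF that(2)] by linarith
  have L21: "L $$ (Suc (m + i), Suc j) = - P $$ (Suc i, Suc j)" if "i < m" "j < m" for i j
    using L2[of i "Suc j"] P2[of i "Suc j"] that by simp
  have B_eq: "B i j = - P $$ (Suc i, Suc j)" if "i < m" "j < m" for i j
    unfolding B_def using L21[OF that(2,1)] L_sym[of "Suc i" "Suc (m + j)"] P_sym'[of "Suc i" "Suc j"] that
    by simp
  show L22: "L $$ (Suc (m + i), Suc (m + j)) = (if i = j then 1 else 0)" if "i < m" "j < m" for i j
    using L2[of i "Suc (m + j)"] P2[of i "Suc (m + j)"] P12[OF that] that by simp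
  show B_sym: "B i j = B j i" if "i < m" "j < m" for i j
    using that by (simp add: B_eq P_sym'[of "Suc i"])
  have "t 0 = 0" unfolding t_def using L2 P2 P10 by simp
  then show "L $$ (0, 0) = m / 2"
    using e0[of 0] col[of 0] P0[of 0] by (simp add: field_simps)
  have t1: "t (Suc j) = - 1" if "j < m" for j
    unfolding t_def using that P1_sum by (simp add: L21 sum_negf)
  have s1: "s (Suc j) = 3 / 2" if "j < m" for j
    using e0[of "Suc j"] t1[OF that] P0[of "Suc j"] that by simp
  show L01: "L $$ (0, Suc j) = - 1 / 2" if "j < m" for j
    using s1[OF that] t1[OF that] col[of "Suc j"] that by simp
  have t2: "t (Suc (m + j)) = 1" if "j < m" for j
    unfolding t_def using that by (simp add: L22)
  have s2: "s (Suc (m + j)) = - 1" if "j < m" for j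
    using e0[of "Suc (m + j)"] t2[OF that] P0[of "Suc (m + j)"] that by simp
  show "L $$ (0, Suc (m + j)) = 0" if "j < m" for j
    using s2[OF that] t2[OF that] col[of "Suc (m + j)"] that by simp
  have A_sym: "A i j = A j i" if "i < m" "j < m" for i j
    using that unfolding A_def by (intro L_sym) auto
  show "(\<Sum>k<m. A i k) = 3 / 2" if "i < m" for i
    using s1[OF that] that A_sym[OF that] by (simp add: s_def A_def)
  show "(\<Sum>k<m. B i k) = - 1" if "i < m" for i
  proof -
    have "(\<Sum>k<m. B i k) = (\<Sum>k<m. B k i)" using that B_sym by (intro sum.cong) auto
    then show ?thesis using P1_sum[OF that] that by (simp add: B_eq sum_negf)
  qed
  show "(\<Sum>k<m. B i k * S $$ (k, j)) = - S $$ (i, j)" if "i < m" "j < m" for i j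
  proof -
    have "(\<Sum>k<m. B i k * S $$ (k, j)) = (\<Sum>k<m. - (S $$ (j, k) * P $$ (Suc k, Suc i)))"
      using that by (intro sum.cong) (simp_all add: B_eq P_sym'[of "Suc i"] S_sym[of _ j])
    then show ?thesis using SP[OF that(2,1)] S_sym[OF that] by (simp add: sum_negf)
  qed
  \<comment> \<open>The rim rows of P L = L: rim columns give B A = -A, pendant columns give B B =
    -B.\<close>
  have PL1: "(\<Sum>k<m. B i k * L $$ (Suc k, j)) = - L $$ (Suc i, j)" if "i < m" "j < ?N" for i j
    using PL[of "Suc i" j] that unfolding sum_lessThan_blocks
    by (simp add: B_eq P10 P12 sum_negf)
  show "(\<Sum>k<m. B i k * A k j) = - A i j" if "i < m" "j < m" for i j
    unfolding A_def using PL1 that by simp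
  show "(\<Sum>k<m. B i k * B k j) = - B i j" if "i < m" "j < m" for i j
    using PL1[of i "Suc (m + j)"] that by (simp add: B_def)
  show "(\<Sum>k<m. (A i k + B i k) * S $$ (k, j)) = - 2 * B i j" if "i < m" "j < m" for i j
  proof -
    have "(\<Sum>k<m. (A i k + B i k) * S $$ (k, j)) =
        (\<Sum>k<m. S $$ (j, k) * L $$ (Suc k, Suc i) + S $$ (j, k) * L $$ (Suc (m + k), Suc i))"
      using that L_sym by (intro sum.cong) (simp_all add: A_def B_def S_sym[of _ j] algebra_simps)
    \<comment> \<open>In \<open>e1\<close> the terms free of S add up to -1/2 + 2 (3/2) - 3 = -1/2,
      which matches 2 w on the rim.\<close>
    also have "\<dots> = 2 * P $$ (Suc j, Suc i)"
      using e1[of j "Suc i"] s1[of i] t1[of i] L01[of i] that by (simp add: sum.distrib)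
    also have "\<dots> = - 2 * B i j"
      using B_sym[OF that] that by (simp add: B_eq)
    finally show ?thesis .
  qed
qed

end


section \<open>Matrix equations as entrywise sums, and the passage back to the helm graph\<close>

lemma mult_ones_vec_eq_iff:
  assumes "A \<in> carrier_mat m m"
  shows "A *\<^sub>v ones_vec m = c \<cdot>\<^sub>v ones_vec m \<longleftrightarrow> (\<forall>i<m. (\<Sum>k<m. A $$ (i, k)) = c)"
  using assms by (auto simp: vec_eq_iff scalar_prod_def lessThan_atLeast0)

lemma mult_mat_eq_iff:
  assumes "A \<in> carrier_mat m m" "B \<in> carrier_mat m m" "C \<in> carrier_mat m m"
  shows "A * B = C \<longleftrightarrow> (\<forall>i<m. \<forall>j<m. (\<Sum>k<m. A $$ (i, k) * B $$ (k, j)) = C $$ (i, j))"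
  using assms by (auto simp: mat_eq_iff index_mult_mat_sum[of _ m m _ m] simp del: index_mult_mat(1))

lemma add_one_mult_eq_zero_iff:
  fixes A B :: "real mat"
  assumes "A \<in> carrier_mat m m" "B \<in> carrier_mat m m"
  shows "(B + 1\<^sub>m m) * A = 0\<^sub>m m m \<longleftrightarrow>
    (\<forall>i<m. \<forall>j<m. (\<Sum>k<m. B $$ (i, k) * A $$ (k, j)) = - A $$ (i, j))"
proof -
  have "(\<Sum>k<m. (B + 1\<^sub>m m) $$ (i, k) * A $$ (k, j)) =
      (\<Sum>k<m. B $$ (i, k) * A $$ (k, j)) + A $$ (i, j)" if "i < m" for i j
    using assms that by (simp add: distrib_right sum.distrib if_distrib[of "\<lambda>x. x * _"] cong: if_cong)
  then show ?thesis
    using assms by (subst mult_mat_eq_iff) (auto simp: eq_neg_iff_add_eq_0)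
qed

lemma bordered_block_mat:
  fixes A B :: "real mat" and a b :: real
  assumes "A \<in> carrier_mat m m" "B \<in> carrier_mat m m"
  defines "T \<equiv> four_block_mat (mat 1 1 (\<lambda>_. a)) (mat_of_row (b \<cdot>\<^sub>v ones_vec m @\<^sub>v 0\<^sub>v m))
    (transpose_mat (mat_of_row (b \<cdot>\<^sub>v ones_vec m @\<^sub>v 0\<^sub>v m)))
    (four_block_mat A B (transpose_mat B) (1\<^sub>m m))"
  shows "T \<in> carrier_mat (Suc (m + m)) (Suc (m + m))" "T $$ (0, 0) = a"
    "i < m \<Longrightarrow> T $$ (0, Suc i) = b" "i < m \<Longrightarrow> T $$ (0, Suc (m + i)) = 0"
    "i < m \<Longrightarrow> T $$ (Suc i, 0) = b" "i < m \<Longrightarrow> T $$ (Suc (m + i), 0) = 0"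
    "i < m \<Longrightarrow> j < m \<Longrightarrow> T $$ (Suc i, Suc j) = A $$ (i, j)"
    "i < m \<Longrightarrow> j < m \<Longrightarrow> T $$ (Suc i, Suc (m + j)) = B $$ (i, j)"
    "i < m \<Longrightarrow> j < m \<Longrightarrow> T $$ (Suc (m + i), Suc j) = B $$ (j, i)"
    "i < m \<Longrightarrow> j < m \<Longrightarrow> T $$ (Suc (m + i), Suc (m + j)) = (if i = j then 1 else 0)"
  using assms by (auto simp: four_block_mat_def Let_def mat_of_row_def append_vec_def)

lemma helm_blocks_distance_mat:
  assumes n: "n \<ge> 4"
  shows "helm_blocks (n - 1)
    (circ (vec (n - 1) (\<lambda>i. if i = 0 then 2 else if i = 1 \<or> i = n - 2 then 1 else 0)))
    (distance_mat (helm_graph n) (helm_vertices n))"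
    (is "helm_blocks _ (circ ?a) ?D")
proof -
  define m C D where "m = n - 1" and "C = circ ?a" and "D = ?D"
  have C: "C $$ (i, j) = 2 - real (rim_dist n (Suc i) (Suc j))" if "i < m" "j < m" for i j
    using index_circ_rim[OF n] that by (simp only: m_def C_def)
  have len: "length (helm_vertices n) = Suc (m + m)"
    using n by (simp add: helm_vertices_def m_def)
  have D: "D $$ (i, j) = helm_dist n (helm_vertices n ! i) (helm_vertices n ! j)"
    if "i < Suc (m + m)" "j < Suc (m + m)" for i j
  proof -
    have "helm_vertices n ! i \<in> pverts (helm_graph n)" "helm_vertices n ! j \<in> pverts (helm_graph n)"
      using that set_helm_vertices[of n] len by (metis nth_mem)+
    then show ?thesis
      using that by (simp only: D_def distance_mat_def len index_mat prod.case graph_dist_helm_graph[OF n])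
  qed
  have vs: "helm_vertices n ! 0 = V 0" "i < m \<Longrightarrow> helm_vertices n ! Suc i = V (Suc i)"
    "i < m \<Longrightarrow> helm_vertices n ! Suc (m + i) = U (Suc i)" for i
    using n by (auto simp: helm_vertices_def nth_append m_def)
  \<comment> \<open>The entries 2, 1, 1 sit at positions 0, 1 and n - 2, which are distinct because
    n is at least 4.\<close>
  have a_sum: "(\<Sum>j<m. ?a $ j) = 4"
  proof -
    have "(\<Sum>j<m. ?a $ j) = (\<Sum>j<m. (if j = 0 then 2 else 0) + (if j = 1 then 1 else 0)
        + (if j = n - 2 then 1 else 0))"
      using n by (intro sum.cong) (auto simp: m_def)
    then show ?thesis using n by (simp only: sum.distrib) (auto simp: m_def)
  qed
  have "helm_blocks m C D"
  proof
    show "m > 0" using n by (simp add: m_def)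
    show "C \<in> carrier_mat m m" by (simp add: C_def circ_def Let_def m_def)
    show "(\<Sum>j<m. C $$ (i, j)) = 4" if "i < m" for i
      using row_sum_circ[of i ?a] that a_sum by (simp add: C_def m_def)
    show "C $$ (i, j) = C $$ (j, i)" if "i < m" "j < m" for i j
      using that by (simp add: C rim_dist_commute)
    show "D \<in> carrier_mat (Suc (m + m)) (Suc (m + m))"
      by (simp add: D_def distance_mat_def len)
  qed (simp_all add: D vs C rim_dist_def[of n 0] rim_dist_def[of n _ 0])
  then show ?thesis by (simp only: m_def C_def D_def)
qed

theorem theorem4p5:
  fixes n :: nat and D S L :: "real mat"
  assumes "n \<ge> 4"
    and "D = distance_mat (helm_graph n) (helm_vertices n)"
    and "S = circ (vec (n - 1) (\<lambda>i. if i = 0 then 2 else if i = 1 \<or> i = n - 2 then 1 else 0))"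
    and "L \<in> carrier_mat (2 * n - 1) (2 * n - 1)"
  shows
    "(laplacian_like L \<and>
      (\<exists>(\<alpha> :: real) w. \<alpha> \<noteq> 0 \<and> w \<in> carrier_vec (2 * n - 1) \<and> ones_vec (2 * n - 1) \<bullet> w = 1 \<and>
         moore_penrose_inverse D = (- 1 / 2) \<cdot>\<^sub>m L + \<alpha> \<cdot>\<^sub>m outer_prod w w))
     \<longleftrightarrow>
     (\<exists>A B. A \<in> carrier_mat (n - 1) (n - 1) \<and> B \<in> carrier_mat (n - 1) (n - 1) \<and>
        symmetric_mat A \<and> symmetric_mat B \<and>
        L = four_block_mat
              (mat 1 1 (\<lambda>_. (real n - 1) / 2))
              (mat_of_row ((- 1 / 2) \<cdot>\<^sub>v ones_vec (n - 1) @\<^sub>v 0\<^sub>v (n - 1)))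
              (transpose_mat (mat_of_row ((- 1 / 2) \<cdot>\<^sub>v ones_vec (n - 1) @\<^sub>v 0\<^sub>v (n - 1))))
              (four_block_mat A B (transpose_mat B) (1\<^sub>m (n - 1))) \<and>
        A *\<^sub>v ones_vec (n - 1) = (3 / 2) \<cdot>\<^sub>v ones_vec (n - 1) \<and>
        B *\<^sub>v ones_vec (n - 1) = - ones_vec (n - 1) \<and>
        B * S = - S \<and>
        (B + 1\<^sub>m (n - 1)) * A = 0\<^sub>m (n - 1) (n - 1) \<and>
        (B + 1\<^sub>m (n - 1)) * B = 0\<^sub>m (n - 1) (n - 1) \<and>
        (A + B) * S + 2 \<cdot>\<^sub>m B = 0\<^sub>m (n - 1) (n - 1))"
proof -
  define m where "m = n - 1"
  let ?N = "Suc (m + m)"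
  interpret helm_blocks m S D
    unfolding m_def assms(2,3) by (rule helm_blocks_distance_mat) (rule assms(1))
  have N: "2 * n - 1 = ?N" and n1: "n - 1 = m" and rn: "real n - 1 = real m"
    using assms(1) by (auto simp: m_def)
  have Lc: "L \<in> carrier_mat ?N ?N" using assms(4) unfolding N .
  let ?r = "mat_of_row ((- 1 / 2) \<cdot>\<^sub>v ones_vec m @\<^sub>v 0\<^sub>v m)"
  let ?T = "\<lambda>A B. four_block_mat (mat 1 1 (\<lambda>_. real m / 2)) ?r (transpose_mat ?r)
    (four_block_mat A B (transpose_mat B) (1\<^sub>m m))"
  note T = bordered_block_mat[where a = "real m / 2" and b = "- 1 / 2"]
  \<comment> \<open>Puts condition (ii) into the scalar-multiple form of
    \<open>mult_ones_vec_eq_iff\<close>.\<close>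
  have neg_ones: "- ones_vec m = (- 1) \<cdot>\<^sub>v ones_vec m" by (intro eq_vecI) auto
  have ABS_iff: "(A + B) * S + 2 \<cdot>\<^sub>m B = 0\<^sub>m m m \<longleftrightarrow>
      (\<forall>i<m. \<forall>j<m. (\<Sum>k<m. (A $$ (i, k) + B $$ (i, k)) * S $$ (k, j)) = - 2 * B $$ (i, j))"
    if A: "A \<in> carrier_mat m m" and B: "B \<in> carrier_mat m m" for A B
  proof -
    have "((A + B) * S + 2 \<cdot>\<^sub>m B) $$ (i, j) =
        (\<Sum>k<m. (A $$ (i, k) + B $$ (i, k)) * S $$ (k, j)) + 2 * B $$ (i, j)"
      if "i < m" "j < m" for i j
      using that A B S_carrier
      by (simp add: index_mult_mat_sum[of _ m m _ m] del: index_mult_mat(1))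
    then show ?thesis
      using A B S_carrier by (auto simp: mat_eq_iff eq_neg_iff_add_eq_0 simp del: index_mult_mat(1))
  qed
  show ?thesis
    unfolding N n1 rn neg_ones
  proof (intro iffI; elim conjE exE)
    fix \<alpha> w
    assume lap: "laplacian_like L" and w: "w \<in> carrier_vec ?N" "ones_vec ?N \<bullet> w = 1"
      and X: "moore_penrose_inverse D = (- 1 / 2) \<cdot>\<^sub>m L + \<alpha> \<cdot>\<^sub>m outer_prod w w"
    have L_sym: "\<And>i j. i < ?N \<Longrightarrow> j < ?N \<Longrightarrow> L $$ (i, j) = L $$ (j, i)"
      using lap unfolding laplacian_like_iff[OF Lc] by blast
    have "(\<Sum>i<?N. w $ i) = 1"
      using w by (simp add: scalar_prod_def lessThan_atLeast0)
    then have form: "is_moore_penrose_inverse D ((- 1 / 2) \<cdot>\<^sub>m L + \<alpha> \<cdot>\<^sub>m outer_prod w w)"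
      and sum_w: "(\<Sum>i<?N. w $ i) = 1"
      using is_moore_penrose_inverse_symmetric[OF D_carrier D_sym] X by auto
    note blocks = blocks_of_moore_penrose[OF Lc lap w(1) sum_w form]
    define A B where "A = mat m m (\<lambda>(i, j). L $$ (Suc i, Suc j))"
      and "B = mat m m (\<lambda>(i, j). L $$ (Suc i, Suc (m + j)))"
    have A: "A \<in> carrier_mat m m" and B: "B \<in> carrier_mat m m" by (simp_all add: A_def B_def)
    have L_lower: "L $$ (Suc i, 0) = - 1 / 2" "L $$ (Suc (m + i), 0) = 0" if "i < m" for i
      using that blocks(2,3)[OF that] L_sym[of 0 "Suc i"] L_sym[of 0 "Suc (m + i)"] by simp_all
    have L_lower': "L $$ (Suc (m + i), Suc j) = L $$ (Suc j, Suc (m + i))" if "i < m" "j < m" for i j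
      using that by (intro L_sym) auto
    have "L = ?T A B"
    proof (rule eq_matI)
      fix i j assume "i < dim_row (?T A B)" "j < dim_col (?T A B)"
      then have "i < ?N" "j < ?N" using T(1)[OF A B] by auto
      then show "L $$ (i, j) = ?T A B $$ (i, j)"
        by (elim less_blocks_cases; simp only: T[OF A B])
          (simp_all add: blocks(1-4) A_def B_def L_lower L_lower')
    qed (use Lc T(1)[OF A B] in auto)
    moreover have "symmetric_mat A" "symmetric_mat B"
      using L_sym blocks(5) by (auto simp: symmetric_mat_def mat_eq_iff A_def B_def)
    moreover have "A *\<^sub>v ones_vec m = (3 / 2) \<cdot>\<^sub>v ones_vec m"
      unfolding mult_ones_vec_eq_iff[OF A] using blocks(6) by (simp add: A_def)
    moreover have "B *\<^sub>v ones_vec m = (- 1) \<cdot>\<^sub>v ones_vec m"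
      unfolding mult_ones_vec_eq_iff[OF B] using blocks(7) by (simp add: B_def)
    moreover have "B * S = - S"
      using S_carrier blocks(8) by (subst mult_mat_eq_iff[OF B S_carrier]) (simp_all add: B_def)
    moreover have "(B + 1\<^sub>m m) * A = 0\<^sub>m m m"
      unfolding add_one_mult_eq_zero_iff[OF A B] using blocks(9) by (simp add: A_def B_def)
    moreover have "(B + 1\<^sub>m m) * B = 0\<^sub>m m m"
      unfolding add_one_mult_eq_zero_iff[OF B B] using blocks(10) by (simp add: B_def)
    moreover have "(A + B) * S + 2 \<cdot>\<^sub>m B = 0\<^sub>m m m"
      unfolding ABS_iff[OF A B] using blocks(11) by (simp add: A_def B_def)
    ultimately show "\<exists>A B. A \<in> carrier_mat m m \<and> B \<in> carrier_mat m m \<and>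
        symmetric_mat A \<and> symmetric_mat B \<and> L = ?T A B \<and>
        A *\<^sub>v ones_vec m = (3 / 2) \<cdot>\<^sub>v ones_vec m \<and> B *\<^sub>v ones_vec m = (- 1) \<cdot>\<^sub>v ones_vec m \<and>
        B * S = - S \<and> (B + 1\<^sub>m m) * A = 0\<^sub>m m m \<and> (B + 1\<^sub>m m) * B = 0\<^sub>m m m \<and>
        (A + B) * S + 2 \<cdot>\<^sub>m B = 0\<^sub>m m m"
      using A B by blast
  next
    fix A B
    assume A: "A \<in> carrier_mat m m" and B: "B \<in> carrier_mat m m"
      and sym: "symmetric_mat A" "symmetric_mat B" and L: "L = ?T A B"
      and conds: "A *\<^sub>v ones_vec m = (3 / 2) \<cdot>\<^sub>v ones_vec m" "B *\<^sub>v ones_vec m = (- 1) \<cdot>\<^sub>v ones_vec m"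
        "B * S = - S" "(B + 1\<^sub>m m) * A = 0\<^sub>m m m" "(B + 1\<^sub>m m) * B = 0\<^sub>m m m"
        "(A + B) * S + 2 \<cdot>\<^sub>m B = 0\<^sub>m m m"
    have A_sym: "\<And>i j. i < m \<Longrightarrow> j < m \<Longrightarrow> A $$ (i, j) = A $$ (j, i)"
      and B_sym: "\<And>i j. i < m \<Longrightarrow> j < m \<Longrightarrow> B $$ (i, j) = B $$ (j, i)"
      using sym A B by (auto simp: symmetric_mat_def mat_eq_iff)
    have S_neg: "(- S) $$ (i, j) = - S $$ (i, j)" if "i < m" "j < m" for i j
      using that S_carrier by auto
    have nS: "- S \<in> carrier_mat m m" using S_carrier by simp
    note entries = T(2-)[OF A B, folded L]
    note conds' = conds(1)[unfolded mult_ones_vec_eq_iff[OF A]] conds(2)[unfolded mult_ones_vec_eq_iff[OF B]]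
      conds(3)[unfolded mult_mat_eq_iff[OF B S_carrier nS]]
      conds(4)[unfolded add_one_mult_eq_zero_iff[OF A B]]
      conds(5)[unfolded add_one_mult_eq_zero_iff[OF B B]] conds(6)[unfolded ABS_iff[OF A B]]
    have "is_moore_penrose_inverse D ((- 1 / 2) \<cdot>\<^sub>m L + (4 / (3 * real m)) \<cdot>\<^sub>m outer_prod wt wt)"
      by (rule moore_penrose_of_blocks[OF A B A_sym B_sym Lc])
        (use conds' S_neg in \<open>simp_all add: entries\<close>)
    then have "moore_penrose_inverse D = (- 1 / 2) \<cdot>\<^sub>m L + (4 / (3 * real m)) \<cdot>\<^sub>m outer_prod wt wt"
      by (rule moore_penrose_inverse_eqI)
    moreover have "ones_vec ?N \<bullet> wt = 1"
      using sum_wt wt_carrier by (simp add: scalar_prod_def lessThan_atLeast0)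
    moreover have "laplacian_like L"
      unfolding laplacian_like_iff[OF Lc]
    proof (intro conjI allI impI)
      fix i j assume "i < ?N" "j < ?N"
      then show "L $$ (i, j) = L $$ (j, i)"
        by (elim less_blocks_cases) (simp_all add: entries A_sym B_sym)
    next
      fix i assume i: "i < ?N"
      \<comment> \<open>The pendant rows of \<open>L\<close> contain the transpose of
        \<open>B\<close>, so their row sums need the column sums of \<open>B\<close>.\<close>
      have "(\<Sum>k<m. B $$ (k, j)) = - 1" if "j < m" for j
        using conds'(2) that by (simp add: B_sym[of _ j])
      then show "(\<Sum>j<?N. L $$ (i, j)) = 0"
        using i conds'(1,2) unfolding sum_lessThan_blocks
        by (elim less_blocks_cases) (simp_all add: entries)
    qed
    ultimately show "laplacian_like L \<and> (\<exists>(\<alpha> :: real) w. \<alpha> \<noteq> 0 \<and> w \<in> carrier_vec ?N \<and>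
        ones_vec ?N \<bullet> w = 1 \<and>
        moore_penrose_inverse D = (- 1 / 2) \<cdot>\<^sub>m L + \<alpha> \<cdot>\<^sub>m outer_prod w w)"
      using m_pos wt_carrier by (intro conjI exI[of _ "4 / (3 * real m)"] exI[of _ wt]) simp_all
  qed
qed

end
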